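(* Let $E$ be a uniformly smooth and uniformly convex real Banach space with dual $E^{*}$ and normalized duality mapping $J:E\to E^{*}$, and let $C\subset E$ be nonempty, closed and convex such that $JC=\{Jc: c\in C\}$ is closed and convex. Let $\{f_i\}_{i=1}^{\infty}$ be bifunctions $JC\times JC\to\mathbb{R}$ each satisfying conditions (A1)--(A4) (see context), let $\{A_j\}_{j=1}^{\infty}$ be continuous monotone mappings from $C$ into $E^{*}$, and let $\{M_k\}_{k=1}^{\infty}$ be maximal monotone operators from $E$ into $2^{E^{*}}$ such that $G_r^{M_k}(C)\subset C$ for all $r>0$ and $k\in\mathbb{N}$. Let $\{T_n\}_{n=1}^{\infty}$ be generalized $J_{*}$-nonexpansive mappings from $C$ into $E^{*}$, and let $\Gamma$ be a family of $J_{*}$-closed generalized $J_{*}$-nonexpansive mappings from $C$ into $E^{*}$ such that $$\bigcap_{n=1}^{\infty}F_J(T_n)=F_J(\Gamma)\neq\emptyset .$$ Let $\sigma,\tau,\rho:\mathbb N\to\mathbb N$ be maps such that every positive integer occurs infinitely many times in each of the sequences $\{\sigma(n)\}$, $\{\tau(n)\}$, $\{\rho(n)\}$. Assume that $$B:=F_J(\Gamma)\cap\Big(\bigcap_{i=1}^{\infty}EP(f_i)\Big)\cap\Big(\bigcap_{j=1}^{\infty}VI(C,A_j)\Big)\cap\Big(\bigcap_{k=1}^{\infty}M_k^{-1}0\Big)$$ is nonempty, closed and convex. Let $\{r_n\}\subset[a,\infty)$ for some $a>0$, and let $\alpha_i\in(0,1)$, $i=1,\dots,5$, satisfy $\sum_{i=1}^{5}\alpha_i=1$.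 Suppose that $\{x_n\}$ is generated by $x_1=x\in C$, $C_1=C$ and, for all $n\in\mathbb N$, $$\begin{aligned} z_n&=T_{r_n}^{f_{\sigma(n)}}x_n,\qquad u_n=F_{r_n}^{A_{\tau(n)}}x_n,\qquad q_n=G_{r_n}^{M_{\rho(n)}}x_n,\\ y_n&=J^{-1}\big(\alpha_1Jx_n+\alpha_2Jz_n+\alpha_3Ju_n+\alpha_4Jq_n+\alpha_5T_nq_n\big),\\ C_{n+1}&=\{v\in C_n:\phi(v,y_n)\le\phi(v,x_n)\},\\ x_{n+1}&=\Pi_{C_{n+1}}x . \end{aligned}$$ Suppose also that $\{T_n\}$ satisfies the NST-condition with $\Gamma$: for every bounded sequence $\{s_n\}\subset C$, $$\|Js_n-T_ns_n\|\to0\ \Longrightarrow\ \|Js_n-Ts_n\|\to0\quad\text{for all }T\in\Gamma .$$ Then $\{x_n\}$ converges strongly to $\Pi_Bx$, the generalized projection of the initial point $x$ onto $B$.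
   Context: Notation and definitions. $\langle x,x^{*}\rangle$ is the pairing of $x\in E$ with $x^{*}\in E^{*}$. $J$ is the normalized duality mapping: $Jx$ is the unique $x^*\in E^*$ with $\langle x,x^{*}\rangle=\|x\|\|x^{*}\|$ and $\|x^{*}\|=\|x\|$ (single-valued, one-to-one and onto here); $J_{*}=J^{-1}:E^{*}\to E$. The Lyapunov functional is $\phi(x,y)=\|x\|^{2}-2\langle x,Jy\rangle+\|y\|^{2}$ for $x,y\in E$. For $D\subset E$ nonempty, closed and convex, the generalized projection $\Pi_Dx$ is the unique minimizer of $y\mapsto\phi(y,x)$ over $y\in D$. For $T:C\to E^{*}$: $F_J(T)=\{p\in C:Tp=Jp\}$; for a family $\Gamma$ of such maps, $F_J(\Gamma)=\bigcap_{T\in\Gamma}F_J(T)$. $T$ is generalized $J_{*}$-nonexpansive if $F_J(T)\ne\emptyset$ and $\phi(p,(J_{*}\circ T)x)\le\phi(p,x)$ for all $x\in C$, $p\in F_J(T)$. $T$ is $J_{*}$-closed if $x_n\to x$ and $(J_{*}\circ T)x_n\to y$ (with $x_n,x\in C$) imply $y=(J_{*}\circ T)x$. Conditions on $f:JC\times JC\to\mathbb R$: (A1) $f(x^{*},x^{*})=0$ for all $x^*\in JC$; (A2) $f(x^{*},y^{*})+f(y^{*},x^{*})\le0$ for all $x^*,y^*\in JC$; (A3) $\limsup_{t\downarrow0}f(tz^{*}+(1-t)x^{*},y^{*})\le f(x^{*},y^{*})$ for all $x^{*},y^{*},z^{*}\in JC$; (A4) for each $x^{*}\in JC$, $f(x^{*},\cdot)$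 is convex and lower semicontinuous. Solution sets: $EP(f)=\{x\in C: f(Jx,Jy)\ge0\ \forall y\in C\}$; for $A:C\to E^*$, $VI(C,A)=\{x\in C:\langle y-x,Ax\rangle\ge0\ \forall y\in C\}$; $M^{-1}0=\{x\in E:0\in Mx\}$. $A:C\to E^*$ is monotone if $\langle x-y,Ax-Ay\rangle\ge 0$ for all $x,y\in C$; an operator $M:E\to2^{E^{*}}$ is monotone if $\langle x-y,x^{*}-y^{*}\rangle\ge0$ whenever $x^{*}\in Mx$, $y^{*}\in My$, and maximal monotone if its graph is not properly contained in the graph of another monotone operator. Resolvents ($r>0$, $x\in E$): $T_r^fx$ is the point $z\in C$ with $f(Jz,Jy)+\frac1r\langle y-z,Jz-Jx\rangle\ge0$ for all $y\in C$; $F_r^Ax$ is the point $z\in C$ with $\langle y-z,Az\rangle+\frac1r\langle y-z,Jz-Jx\rangle\ge0$ for all $y\in C$; $G_r^M=(J+rM)^{-1}J$, i.e. $q=G_r^Mx$ iff $\frac{Jx-Jq}{r}\in Mq$. As part of the setting, $T_r^{f_i},F_r^{A_j}:E\to C$ and $G_r^{M_k}:E\to E$ are everywhere-defined single-valued maps. *)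

theory Defs
  imports "HOL-Analysis.Analysis"
begin

text \<open>The real Banach space \<open>E\<close> is a type \<open>'a::banach\<close>; its dual is the type of bounded
  linear functionals with the operator norm.\<close>

type_synonym 'a dual = "'a \<Rightarrow>\<^sub>L real"

abbreviation pairing :: "'a::real_normed_vector \<Rightarrow> 'a dual \<Rightarrow> real"
  where "pairing x xs \<equiv> blinfun_apply xs x"

definition uniformly_convex_space :: "'a::real_normed_vector itself \<Rightarrow> bool"
  where "uniformly_convex_space _ \<longleftrightarrow>
    (\<forall>\<epsilon>\<in>{0<..2}. \<exists>\<delta>>0. \<forall>x y :: 'a. norm x = 1 \<longrightarrow> norm y = 1 \<longrightarrow> norm (x - y) \<ge> \<epsilon> \<longrightarrow>
      norm ((1/2) *\<^sub>R (x + y)) \<le> 1 - \<delta>)"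

text \<open>The modulus of smoothness \<open>\<rho>(t) = sup {(\<parallel>x + y\<parallel> + \<parallel>x - y\<parallel>) / 2 - 1 : \<parallel>x\<parallel> = 1, \<parallel>y\<parallel> = t}\<close>
  satisfies \<open>\<rho>(t) / t \<rightarrow> 0\<close> as \<open>t \<down> 0\<close>. The condition is spelled out, which avoids suprema over
  the empty set in the zero space.\<close>

definition uniformly_smooth_space :: "'a::real_normed_vector itself \<Rightarrow> bool"
  where "uniformly_smooth_space _ \<longleftrightarrow>
    (\<forall>\<epsilon>>0. \<exists>\<delta>>0. \<forall>x y :: 'a. norm x = 1 \<longrightarrow> norm y \<le> \<delta> \<longrightarrow>
      (norm (x + y) + norm (x - y)) / 2 - 1 \<le> \<epsilon> * norm y)"

definition duality_map :: "'a::real_normed_vector \<Rightarrow> 'a dual"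
  where "duality_map x = (THE xs. pairing x xs = norm x * norm xs \<and> norm xs = norm x)"

definition duality_map_inv :: "'a::real_normed_vector dual \<Rightarrow> 'a"
  where "duality_map_inv = inv duality_map"

definition lyapunov :: "'a::real_normed_vector \<Rightarrow> 'a \<Rightarrow> real"
  where "lyapunov x y = (norm x)\<^sup>2 - 2 * pairing x (duality_map y) + (norm y)\<^sup>2"

definition gen_proj :: "'a::real_normed_vector set \<Rightarrow> 'a \<Rightarrow> 'a"
  where "gen_proj D x = (THE z. is_arg_min (\<lambda>y. lyapunov y x) (\<lambda>y. y \<in> D) z)"


text \<open>A map defined on \<open>C\<close> is a total function of which only the values on \<open>C\<close> are used;
  this is why \<open>C\<close> is an explicit argument below.\<close>

definition F_J :: "'a::real_normed_vector set \<Rightarrow> ('a \<Rightarrow> 'a dual) \<Rightarrow> 'a set"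
  where "F_J C T = {p \<in> C. T p = duality_map p}"

definition F_J_family :: "'a::real_normed_vector set \<Rightarrow> ('a \<Rightarrow> 'a dual) set \<Rightarrow> 'a set"
  where "F_J_family C \<Gamma> = (\<Inter>T\<in>\<Gamma>. F_J C T)"

definition gen_Jstar_nonexpansive :: "'a::real_normed_vector set \<Rightarrow> ('a \<Rightarrow> 'a dual) \<Rightarrow> bool"
  where "gen_Jstar_nonexpansive C T \<longleftrightarrow>
    F_J C T \<noteq> {} \<and>
    (\<forall>x\<in>C. \<forall>p\<in>F_J C T. lyapunov p ((duality_map_inv \<circ> T) x) \<le> lyapunov p x)"

definition Jstar_closed :: "'a::real_normed_vector set \<Rightarrow> ('a \<Rightarrow> 'a dual) \<Rightarrow> bool"
  where "Jstar_closed C T \<longleftrightarrow>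
    (\<forall>s x y. (\<forall>n. s n \<in> C) \<longrightarrow> x \<in> C \<longrightarrow> s \<longlonglongrightarrow> x \<longrightarrow>
      (\<lambda>n. (duality_map_inv \<circ> T) (s n)) \<longlonglongrightarrow> y \<longrightarrow> y = (duality_map_inv \<circ> T) x)"

definition NST_condition ::
    "'a::real_normed_vector set \<Rightarrow> (nat \<Rightarrow> 'a \<Rightarrow> 'a dual) \<Rightarrow> ('a \<Rightarrow> 'a dual) set \<Rightarrow> bool"
  where "NST_condition C T \<Gamma> \<longleftrightarrow>
    (\<forall>s. (\<forall>n\<ge>1. s n \<in> C) \<longrightarrow> bounded (s ` {1..}) \<longrightarrow>
      (\<lambda>n. norm (duality_map (s n) - T n (s n))) \<longlonglongrightarrow> 0 \<longrightarrow>
      (\<forall>S\<in>\<Gamma>. (\<lambda>n. norm (duality_map (s n) - S (s n))) \<longlonglongrightarrow> 0))"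


definition lsc_on :: "'b::topological_space set \<Rightarrow> ('b \<Rightarrow> real) \<Rightarrow> bool"
  where "lsc_on S g \<longleftrightarrow> (\<forall>x\<in>S. ereal (g x) \<le> Liminf (at x within S) (\<lambda>y. ereal (g y)))"

text \<open>Conditions (A1)--(A4) on a bifunction on a set \<open>K\<close>, which will be \<open>JC\<close>.\<close>

definition equilibrium_bifunction ::
    "'b::real_normed_vector set \<Rightarrow> ('b \<Rightarrow> 'b \<Rightarrow> real) \<Rightarrow> bool"
  where "equilibrium_bifunction K f \<longleftrightarrow>
    (\<forall>x\<in>K. f x x = 0) \<and>
    (\<forall>x\<in>K. \<forall>y\<in>K. f x y + f y x \<le> 0) \<and>
    (\<forall>x\<in>K. \<forall>y\<in>K. \<forall>z\<in>K.
      Limsup (at_right 0) (\<lambda>t. ereal (f (t *\<^sub>R z + (1 - t) *\<^sub>R x) y)) \<le> ereal (f x y)) \<and>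
    (\<forall>x\<in>K. convex_on K (f x) \<and> lsc_on K (f x))"

definition EP :: "'a::real_normed_vector set \<Rightarrow> ('a dual \<Rightarrow> 'a dual \<Rightarrow> real) \<Rightarrow> 'a set"
  where "EP C f = {x \<in> C. \<forall>y\<in>C. f (duality_map x) (duality_map y) \<ge> 0}"

definition VI :: "'a::real_normed_vector set \<Rightarrow> ('a \<Rightarrow> 'a dual) \<Rightarrow> 'a set"
  where "VI C A = {x \<in> C. \<forall>y\<in>C. pairing (y - x) (A x) \<ge> 0}"

definition zeros :: "('a::real_normed_vector \<Rightarrow> 'a dual set) \<Rightarrow> 'a set"
  where "zeros M = {x. 0 \<in> M x}"

definition monotone_map_on :: "'a::real_normed_vector set \<Rightarrow> ('a \<Rightarrow> 'a dual) \<Rightarrow> bool"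
  where "monotone_map_on C A \<longleftrightarrow> (\<forall>x\<in>C. \<forall>y\<in>C. pairing (x - y) (A x - A y) \<ge> 0)"

definition monotone_operator :: "('a::real_normed_vector \<Rightarrow> 'a dual set) \<Rightarrow> bool"
  where "monotone_operator M \<longleftrightarrow>
    (\<forall>x y. \<forall>xs\<in>M x. \<forall>ys\<in>M y. pairing (x - y) (xs - ys) \<ge> 0)"

definition operator_graph :: "('a::real_normed_vector \<Rightarrow> 'a dual set) \<Rightarrow> ('a \<times> 'a dual) set"
  where "operator_graph M = {(x, xs). xs \<in> M x}"

definition maximal_monotone :: "('a::real_normed_vector \<Rightarrow> 'a dual set) \<Rightarrow> bool"
  where "maximal_monotone M \<longleftrightarrow>
    monotone_operator M \<and> \<not> (\<exists>N. monotone_operator N \<and> operator_graph M \<subset> operator_graph N)"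


text \<open>Each resolvent is given by the relation between \<open>x\<close> and its value, and by the function that
  this relation determines; the function is meaningful where the relation has a unique solution.\<close>

definition is_resolvent_EP ::
    "'a::real_normed_vector set \<Rightarrow> ('a dual \<Rightarrow> 'a dual \<Rightarrow> real) \<Rightarrow> real \<Rightarrow> 'a \<Rightarrow> 'a \<Rightarrow> bool"
  where "is_resolvent_EP C f r x z \<longleftrightarrow>
    z \<in> C \<and> (\<forall>y\<in>C. f (duality_map z) (duality_map y)
      + (1/r) * pairing (y - z) (duality_map z - duality_map x) \<ge> 0)"

definition resolvent_EP ::
    "'a::real_normed_vector set \<Rightarrow> ('a dual \<Rightarrow> 'a dual \<Rightarrow> real) \<Rightarrow> real \<Rightarrow> 'a \<Rightarrow> 'a"
  where "resolvent_EP C f r x = (THE z. is_resolvent_EP C f r x z)"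

definition is_resolvent_VI ::
    "'a::real_normed_vector set \<Rightarrow> ('a \<Rightarrow> 'a dual) \<Rightarrow> real \<Rightarrow> 'a \<Rightarrow> 'a \<Rightarrow> bool"
  where "is_resolvent_VI C A r x z \<longleftrightarrow>
    z \<in> C \<and> (\<forall>y\<in>C. pairing (y - z) (A z)
      + (1/r) * pairing (y - z) (duality_map z - duality_map x) \<ge> 0)"

definition resolvent_VI ::
    "'a::real_normed_vector set \<Rightarrow> ('a \<Rightarrow> 'a dual) \<Rightarrow> real \<Rightarrow> 'a \<Rightarrow> 'a"
  where "resolvent_VI C A r x = (THE z. is_resolvent_VI C A r x z)"

text \<open>\<open>q = (J + r M)\<^sup>-\<^sup>1 (J x)\<close>, that is, \<open>(J x - J q) / r \<in> M q\<close>.\<close>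

definition is_resolvent_op ::
    "('a::real_normed_vector \<Rightarrow> 'a dual set) \<Rightarrow> real \<Rightarrow> 'a \<Rightarrow> 'a \<Rightarrow> bool"
  where "is_resolvent_op M r x q \<longleftrightarrow> (1/r) *\<^sub>R (duality_map x - duality_map q) \<in> M q"

definition resolvent_op :: "('a::real_normed_vector \<Rightarrow> 'a dual set) \<Rightarrow> real \<Rightarrow> 'a \<Rightarrow> 'a"
  where "resolvent_op M r x = (THE q. is_resolvent_op M r x q)"

end

theory Submission
  imports Defs
begin

text \<open>For \<open>p \<in> B\<close> each resolvent satisfies \<open>\<phi>(p, z) + \<phi>(z, x) \<le> \<phi>(p, x)\<close>, so convexity of
  \<open>\<phi>(p, J\<^sup>-\<^sup>1 \<cdot>)\<close> gives \<open>\<phi>(p, y\<^sub>n) + \<alpha>\<^sub>2 \<phi>(z\<^sub>n, x\<^sub>n) + \<alpha>\<^sub>3 \<phi>(u\<^sub>n, x\<^sub>n) + \<alpha>\<^sub>4 \<phi>(q\<^sub>n, x\<^sub>n) \<le> \<phi>(p, x\<^sub>n)\<close>.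
  Hence \<open>B \<subseteq> C\<^sub>n\<close>, and as the sets \<open>C\<^sub>n\<close> are closed, convex and decreasing, uniform convexity makes
  the projections \<open>x\<^sub>n\<close> a Cauchy sequence with a limit \<open>l \<in> \<Inter>C\<^sub>n\<close> that minimizes \<open>\<phi>(\<cdot>, x)\<close> over
  \<open>\<Inter>C\<^sub>n\<close>. Since \<open>x\<^sub>n\<^sub>+\<^sub>1 \<in> C\<^sub>n\<^sub>+\<^sub>1\<close>, also \<open>y\<^sub>n \<rightarrow> l\<close>, and the displayed inequality forces
  \<open>z\<^sub>n, u\<^sub>n, q\<^sub>n \<rightarrow> l\<close>. Solving the definition of \<open>y\<^sub>n\<close> for \<open>T\<^sub>n q\<^sub>n\<close> and using norm continuity of \<open>J\<close>
  yields \<open>T\<^sub>n q\<^sub>n \<rightarrow> J l\<close>, to which the NST-condition applies. Passing to the limit in the resolvent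
  relations along subsequences of constant index gives \<open>l \<in> B\<close>.\<close>

subsection \<open>Uniform convexity and uniform smoothness\<close>

text \<open>The definition speaks of the unit sphere only. On a ball, either the two norms differ
  noticeably and convexity of the real square gives the gain, or they are close and both vectors can
  be rescaled to the sphere, where they remain apart.\<close>

lemma uniformly_convex_norm_square:
  assumes uc: "uniformly_convex_space TYPE('a::real_normed_vector)" and "\<epsilon> > 0"
  obtains \<delta> where "\<delta> > 0"
    "\<And>x y :: 'a. norm x \<le> R \<Longrightarrow> norm y \<le> R \<Longrightarrow> norm (x - y) \<ge> \<epsilon> \<Longrightarrow>
      (norm ((1/2) *\<^sub>R (x + y)))\<^sup>2 \<le> ((norm x)\<^sup>2 + (norm y)\<^sup>2) / 2 - \<delta>"
proof -
  define S where "S = max R 1"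
  \<comment> \<open>When the norms differ by less than \<open>\<epsilon>/4\<close>, rescaling leaves
    a distance of at least \<open>3 * \<epsilon> / (4 * S)\<close>; the cap at 2 keeps
    \<open>e\<close> in the range of the definition.\<close>
  define e where "e = min 2 (3 * \<epsilon> / (4 * S))"
  have S: "S \<ge> 1" "S \<ge> R" by (auto simp: S_def)
  have e: "e \<in> {0<..2}" using S \<open>\<epsilon> > 0\<close> by (auto simp: e_def)
  then obtain d where d: "d > 0"
    "\<And>x y :: 'a. norm x = 1 \<Longrightarrow> norm y = 1 \<Longrightarrow> norm (x - y) \<ge> e \<Longrightarrow> norm ((1/2) *\<^sub>R (x + y)) \<le> 1 - d"
    using uc unfolding uniformly_convex_space_def by blast
  \<comment> \<open>First entry: the gain \<open>(a - b)\<^sup>2 / 4\<close> for unequal norms.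
    Second entry: the gain \<open>d * b\<^sup>2\<close> for close norms, where
    \<open>b \<ge> \<epsilon>/4\<close>.\<close>
  define \<delta> where "\<delta> = min ((\<epsilon>/4)\<^sup>2 / 4) (d * (\<epsilon>/4)\<^sup>2)"
  have main: "(norm ((1/2) *\<^sub>R (x + y)))\<^sup>2 \<le> ((norm x)\<^sup>2 + (norm y)\<^sup>2) / 2 - \<delta>"
    if xR: "norm x \<le> R" and xy: "norm (x - y) \<ge> \<epsilon>" and le: "norm y \<le> norm x" for x y :: 'a
  proof -
    define a b m where "a = norm x" and "b = norm y" and "m = norm ((1/2) *\<^sub>R (x + y))"
    have m: "m \<le> (a + b) / 2" "m \<ge> 0"
      using norm_triangle_ineq[of x y] by (auto simp: m_def a_def b_def)
    have ba: "0 \<le> b" "b \<le> a" "a \<le> S" using le xR S by (auto simp: a_def b_def)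
    have 2: "\<epsilon> \<le> a + b" using xy norm_triangle_ineq4[of x y] by (simp add: a_def b_def)
    have "m\<^sup>2 \<le> (a\<^sup>2 + b\<^sup>2) / 2 - \<delta>"
    proof (cases "a - b \<ge> \<epsilon>/4")
      case True
      have "m\<^sup>2 \<le> ((a + b) / 2)\<^sup>2" using m by (intro power_mono) auto
      moreover have "((a + b) / 2)\<^sup>2 = (a\<^sup>2 + b\<^sup>2) / 2 - (a - b)\<^sup>2 / 4"
        by (simp add: power2_eq_square field_simps)
      moreover have "(\<epsilon>/4)\<^sup>2 \<le> (a - b)\<^sup>2" using True \<open>\<epsilon> > 0\<close> by (intro power_mono) auto
      ultimately show ?thesis by (simp add: \<delta>_def)
    next
      case False
      then have b: "b \<ge> \<epsilon>/4" using 2 \<open>\<epsilon> > 0\<close> by linarith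
      then have b0: "b > 0" "a > 0" using \<open>\<epsilon> > 0\<close> ba by linarith+
      define x' y' where "x' = (1/a) *\<^sub>R x" and "y' = (1/b) *\<^sub>R y"
      have unit: "norm x' = 1" "norm y' = 1" using b0 by (auto simp: x'_def y'_def a_def b_def)
      have x: "x = a *\<^sub>R x'" and y: "y = b *\<^sub>R y'" using b0 by (auto simp: x'_def y'_def)
      have "x - y = b *\<^sub>R (x' - y') + (a - b) *\<^sub>R x'" by (simp add: x y algebra_simps)
      then have "norm (x - y) \<le> b * norm (x' - y') + (a - b)"
        using norm_triangle_ineq[of "b *\<^sub>R (x' - y')" "(a - b) *\<^sub>R x'"] unit ba by simp
      then have "3 * \<epsilon> / 4 \<le> b * norm (x' - y')" using xy False by linarith
      also have "\<dots> \<le> S * norm (x' - y')" using ba by (intro mult_right_mono) auto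
      finally have "norm (x' - y') \<ge> 3 * \<epsilon> / (4 * S)" using S by (simp add: field_simps)
      then have "norm (x' - y') \<ge> e" by (simp add: e_def)
      then have "norm ((1/2) *\<^sub>R (x' + y')) \<le> 1 - d" using d unit by blast
      then have "b * norm ((1/2) *\<^sub>R (x' + y')) \<le> b * (1 - d)" using ba by (intro mult_left_mono) auto
      \<comment> \<open>Splitting off the excess length along \<open>x'\<close> leaves a multiple of
        the midpoint of two unit vectors.\<close>
      moreover have "(1/2) *\<^sub>R (x + y) = b *\<^sub>R ((1/2) *\<^sub>R (x' + y')) + ((a - b)/2) *\<^sub>R x'"
        by (simp add: x y algebra_simps flip: scaleR_add_left) (simp add: field_simps)
      then have "m \<le> b * norm ((1/2) *\<^sub>R (x' + y')) + (a - b)/2"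
        using norm_triangle_ineq[of "b *\<^sub>R ((1/2) *\<^sub>R (x' + y'))" "((a - b)/2) *\<^sub>R x'"] unit ba
        by (simp add: m_def)
      ultimately have "m \<le> (a + b)/2 - b * d" by (simp add: field_simps)
      then have "m\<^sup>2 \<le> ((a + b)/2 - b * d)\<^sup>2" and *: "b * d \<le> (a + b)/2"
        using m(2) by (blast intro: power_mono, linarith)
      moreover have "((a + b)/2 - b * d)\<^sup>2 = ((a + b)/2)\<^sup>2 - (b * d) * ((a + b) - b * d)"
        by (simp add: power2_eq_square field_simps)
      moreover have "(b * d) * ((a + b) - b * d) \<ge> (b * d) * b"
        using * ba d by (intro mult_left_mono) auto
      moreover have "(b * d) * b \<ge> d * (\<epsilon>/4)\<^sup>2"
      proof -
        have "(\<epsilon>/4)\<^sup>2 \<le> b\<^sup>2" using b \<open>\<epsilon> > 0\<close> by (intro power_mono) auto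
        then have "d * (\<epsilon>/4)\<^sup>2 \<le> d * b\<^sup>2" using d by (intro mult_left_mono) auto
        then show ?thesis by (simp add: power2_eq_square mult_ac)
      qed
      moreover have "((a + b) / 2)\<^sup>2 = (a\<^sup>2 + b\<^sup>2) / 2 - (a - b)\<^sup>2 / 4"
        by (simp add: power2_eq_square field_simps)
      moreover have "\<delta> \<le> d * (\<epsilon>/4)\<^sup>2" "(a - b)\<^sup>2 \<ge> 0" by (simp_all add: \<delta>_def)
      ultimately show ?thesis by linarith
    qed
    then show ?thesis by (simp add: m_def a_def b_def)
  qed
  show thesis
  proof
    show "\<delta> > 0" using d \<open>\<epsilon> > 0\<close> by (simp add: \<delta>_def)
    fix x y :: 'a assume "norm x \<le> R" "norm y \<le> R" "norm (x - y) \<ge> \<epsilon>"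
    then show "(norm ((1/2) *\<^sub>R (x + y)))\<^sup>2 \<le> ((norm x)\<^sup>2 + (norm y)\<^sup>2) / 2 - \<delta>"
      using main[of x y] main[of y x] by (cases "norm y \<le> norm x") (auto simp: norm_minus_commute add.commute)
  qed
qed

text \<open>Functionals that almost norm the same unit vector are compared by testing
  \<open>v\<close> at \<open>x + y\<close> and \<open>w\<close> at \<open>x - y\<close>, where
  smoothness bounds the sum of the two norms. Uniqueness and norm continuity of the duality map both
  come from this.\<close>

lemma uniformly_smooth_support_functionals:
  assumes us: "uniformly_smooth_space TYPE('a::real_normed_vector)" and "\<epsilon> > 0"
  obtains \<eta> where "\<eta> > 0"
    "\<And>(x::'a) v w. norm x = 1 \<Longrightarrow> norm v \<le> 1 \<Longrightarrow> norm w \<le> 1 \<Longrightarrow>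
      pairing x v \<ge> 1 - \<eta> \<Longrightarrow> pairing x w \<ge> 1 - \<eta> \<Longrightarrow> norm (v - w) \<le> \<epsilon>"
proof -
  from \<open>\<epsilon> > 0\<close> have "\<epsilon> / 4 > 0" by simp
  then obtain \<delta> where \<delta>: "\<delta> > 0"
    "\<And>x y :: 'a. norm x = 1 \<Longrightarrow> norm y \<le> \<delta> \<Longrightarrow> (norm (x + y) + norm (x - y)) / 2 - 1 \<le> \<epsilon> / 4 * norm y"
    using us unfolding uniformly_smooth_space_def by meson
  show thesis
  proof
    \<comment> \<open>Two deficits of \<open>\<delta> * \<epsilon> / 4\<close> and the smoothness
      excess \<open>\<delta> * \<epsilon> / 2\<close> at \<open>norm y = \<delta>\<close> add up to
      the bound \<open>\<delta> * \<epsilon>\<close> in \<open>key\<close>.\<close>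
    show "\<delta> * \<epsilon> / 4 > 0" using \<delta> \<open>\<epsilon> > 0\<close> by simp
    fix x :: 'a and v w
    assume x: "norm x = 1" and v: "norm v \<le> 1" and w: "norm w \<le> 1"
      and xv: "pairing x v \<ge> 1 - \<delta> * \<epsilon> / 4" and xw: "pairing x w \<ge> 1 - \<delta> * \<epsilon> / 4"
    have ub: "pairing y g \<le> norm y" if "norm g \<le> 1" for y :: 'a and g
    proof -
      have "pairing y g \<le> norm g * norm y" using norm_blinfun[of g y] by simp
      also have "\<dots> \<le> norm y" using that by (simp add: mult_left_le_one_le)
      finally show ?thesis .
    qed
    have key: "pairing y (v - w) \<le> \<delta> * \<epsilon>" if "norm y = \<delta>" for y
    proof -
      have "pairing (x + y) v + pairing (x - y) w \<le> norm (x + y) + norm (x - y)"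
        using ub v w by (intro add_mono) auto
      also have "\<dots> \<le> 2 + 2 * (\<epsilon> / 4 * norm y)"
        using \<delta>(2)[OF x, of y] that by (simp add: field_simps)
      finally show ?thesis
        using that xv xw by (simp add: blinfun.bilinear_simps field_simps)
    qed
    have le: "pairing y (v - w) \<le> \<epsilon> * norm y" for y
    proof (cases "y = 0")
      case False
      have "(\<delta> / norm y) * pairing y (v - w) \<le> \<delta> * \<epsilon>"
        using key[of "(\<delta> / norm y) *\<^sub>R y"] False \<delta> by (simp add: blinfun.scaleR_right)
      then show ?thesis using False \<delta> by (simp add: field_simps)
    qed (simp add: blinfun.zero_right)
    show "norm (v - w) \<le> \<epsilon>"
    proof (rule norm_blinfun_bound)
      fix y show "norm (pairing y (v - w)) \<le> \<epsilon> * norm y"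
        using le[of y] le[of "- y"] by (auto simp: blinfun.minus_right abs_le_iff)
    qed (use \<open>\<epsilon> > 0\<close> in simp)
  qed
qed

text \<open>Uniform smoothness makes the one-sided directional derivative of the norm linear, so support
  functionals are obtained without the Hahn--Banach theorem.\<close>

lemma uniformly_smooth_support_exists:
  assumes us: "uniformly_smooth_space TYPE('a::real_normed_vector)" and x: "norm (x::'a) = 1"
  obtains w where "pairing x w = 1" "norm w \<le> 1"
proof -
  \<comment> \<open>Difference quotients of the norm at \<open>x\<close>. They increase with
    \<open>t\<close> by convexity, so their infimum \<open>g v\<close> is the right-hand directional
    derivative.\<close>
  define Q where "Q t v = (norm (x + t *\<^sub>R v) - 1) / t" for t v
  define g where "g v = (INF t\<in>{0<..}. Q t v)" for v
  have Q_lower: "- norm v \<le> Q t v" if "t > 0" for t v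
  proof -
    have "norm x \<le> norm (x + t *\<^sub>R v) + norm (t *\<^sub>R v)"
      using norm_triangle_ineq4[of "x + t *\<^sub>R v" "t *\<^sub>R v"] by simp
    then show ?thesis using that x by (simp add: Q_def field_simps)
  qed
  have Q_upper: "Q t v \<le> norm v" if "t > 0" for t v
    using norm_triangle_ineq[of x "t *\<^sub>R v"] that x by (simp add: Q_def field_simps)
  have Q_mono: "Q s v \<le> Q t v" if "0 < s" "s \<le> t" for s t v
  proof -
    have "x + s *\<^sub>R v = (1 - s/t) *\<^sub>R x + (s/t) *\<^sub>R (x + t *\<^sub>R v)"
      using that by (simp add: algebra_simps)
    then have "norm (x + s *\<^sub>R v) \<le> (1 - s/t) * norm x + (s/t) * norm (x + t *\<^sub>R v)"
      using that norm_triangle_ineq[of "(1 - s/t) *\<^sub>R x" "(s/t) *\<^sub>R (x + t *\<^sub>R v)"] by simp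
    then have "t * norm (x + s *\<^sub>R v) \<le> t * ((1 - s/t) * norm x + (s/t) * norm (x + t *\<^sub>R v))"
      using that by (intro mult_left_mono) auto
    also have "\<dots> = (t - s) + s * norm (x + t *\<^sub>R v)" using that x by (simp add: field_simps)
    finally show ?thesis using that by (simp add: Q_def field_simps)
  qed
  have bdd: "bdd_below ((\<lambda>t. Q t v) ` {0<..})" for v
    using Q_lower by (intro bdd_belowI[of _ "- norm v"]) auto
  have g_le: "g v \<le> Q t v" if "t > 0" for t v
    unfolding g_def using that by (intro cINF_lower bdd) auto
  have g_ge: "c \<le> g v" if "\<And>t. t > 0 \<Longrightarrow> c \<le> Q t v" for c v
    unfolding g_def using that by (intro cINF_greatest) auto
  have sub: "g (u + v) \<le> g u + g v" for u v
  proof -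
    have *: "g (u + v) \<le> Q s u + Q t v" if st: "s > 0" "t > 0" for s t
    proof -
      define m where "m = min s t"
      have m: "m > 0" "m \<le> s" "m \<le> t" using st by (auto simp: m_def)
      \<comment> \<open>With half the step for \<open>u + v\<close>, its point is the midpoint of
        the points for \<open>u\<close> and \<open>v\<close>.\<close>
      have "x + (m/2) *\<^sub>R (u + v) = (1/2) *\<^sub>R (x + m *\<^sub>R u) + (1/2) *\<^sub>R (x + m *\<^sub>R v)"
        by (simp add: scaleR_add_right flip: scaleR_add_left)
      then have "norm (x + (m/2) *\<^sub>R (u + v)) \<le> (norm (x + m *\<^sub>R u) + norm (x + m *\<^sub>R v)) / 2"
        using norm_triangle_ineq[of "(1/2) *\<^sub>R (x + m *\<^sub>R u)" "(1/2) *\<^sub>R (x + m *\<^sub>R v)"] by simp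
      then have "(2 * norm (x + (m/2) *\<^sub>R (u + v)) - 2) / m
          \<le> ((norm (x + m *\<^sub>R u) - 1) + (norm (x + m *\<^sub>R v) - 1)) / m"
        using m by (intro divide_right_mono) auto
      then have "Q (m/2) (u + v) \<le> Q m u + Q m v"
        unfolding Q_def add_divide_distrib by (simp add: algebra_simps)
      then show ?thesis using g_le[of "m/2" "u + v"] Q_mono[of m s u] Q_mono[of m t v] m by linarith
    qed
    have "g (u + v) - Q t v \<le> g u" if "t > 0" for t using *[OF _ that] by (intro g_ge) (simp add: algebra_simps)
    then have "g (u + v) - g u \<le> g v" by (intro g_ge) (simp add: algebra_simps)
    then show ?thesis by simp
  qed
  have g0: "g 0 = 0" using x by (simp add: g_def Q_def)
  have neg: "g (- v) = - g v" for v
  proof (cases "v = 0")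
    case False
    have "g v + g (- v) \<le> e" if e: "e > 0" for e
    proof -
      \<comment> \<open>Smoothness enters here: with this \<open>d\<close> it bounds
        \<open>Q t v + Q t (- v)\<close> by \<open>2 * d * norm v = e\<close>.\<close>
      define d where "d = e / (2 * norm v)"
      have "d > 0" using e False by (simp add: d_def)
      then obtain \<delta> where \<delta>: "\<delta> > 0"
        "\<And>x y :: 'a. norm x = 1 \<Longrightarrow> norm y \<le> \<delta> \<Longrightarrow> (norm (x + y) + norm (x - y)) / 2 - 1 \<le> d * norm y"
        using us unfolding uniformly_smooth_space_def by meson
      define t where "t = \<delta> / norm v"
      have t: "t > 0" "norm (t *\<^sub>R v) = \<delta>" using \<delta> False by (auto simp: t_def)
      have "((norm (x + t *\<^sub>R v) - 1) + (norm (x + t *\<^sub>R - v) - 1)) / t \<le> (2 * d * (t * norm v)) / t"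
        using \<delta>(2)[OF x, of "t *\<^sub>R v"] t by (intro divide_right_mono) (auto simp: field_simps)
      then have "Q t v + Q t (- v) \<le> 2 * d * norm v"
        using t unfolding Q_def add_divide_distrib by simp
      then show ?thesis using g_le[of t v] g_le[of t "- v"] t False by (simp add: d_def)
    qed
    then have "g v + g (- v) \<le> 0" by (meson field_le_epsilon add_0 le_add_same_cancel1 dense_ge)
    moreover have "0 \<le> g v + g (- v)" using sub[of v "- v"] g0 by simp
    ultimately show ?thesis by simp
  qed (simp add: g0)
  have add: "g (u + v) = g u + g v" for u v
    using sub[of u v] sub[of "- u" "- v"] neg[of u] neg[of v] neg[of "u + v"] by simp
  have pos: "g (c *\<^sub>R v) = c * g v" if c: "c > 0" for c v
  proof -
    have Qc: "Q t (c *\<^sub>R v) = c * Q (c * t) v" if "t > 0" for t using c that by (simp add: Q_def mult.commute)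
    show ?thesis
    proof (rule antisym)
      have "g (c *\<^sub>R v) / c \<le> g v"
      proof (rule g_ge)
        fix t :: real assume "t > 0"
        then show "g (c *\<^sub>R v) / c \<le> Q t v" using g_le[of "t / c" "c *\<^sub>R v"] Qc[of "t/c"] c by (simp add: field_simps)
      qed
      then show "g (c *\<^sub>R v) \<le> c * g v" using c by (simp add: field_simps)
      show "c * g v \<le> g (c *\<^sub>R v)"
      proof (rule g_ge)
        fix t :: real assume "t > 0"
        then show "c * g v \<le> Q t (c *\<^sub>R v)" using g_le[of "c * t" v] Qc[of t] c by simp
      qed
    qed
  qed
  have scale: "g (c *\<^sub>R v) = c * g v" for c v
  proof (cases c "0::real" rule: linorder_cases)
    case less
    then show ?thesis using pos[of "- c" v] neg[of "c *\<^sub>R v"] by simp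
  qed (use pos g0 in auto)
  have le: "g v \<le> norm v" for v using g_le[of 1 v] Q_upper[of 1 v] by simp
  have bound: "norm (g v) \<le> 1 * norm v" for v using le[of v] le[of "- v"] neg[of v] by (auto simp: abs_le_iff)
  have lin: "bounded_linear g"
    using add scale bound by (intro bounded_linear_intro[of g 1]) (auto simp: mult.commute)
  have Qx: "Q t x = 1" if "t > 0" for t
  proof -
    have "x + t *\<^sub>R x = (1 + t) *\<^sub>R x" by (simp add: algebra_simps)
    then have "norm (x + t *\<^sub>R x) = 1 + t" using x that by simp
    then show ?thesis using that by (simp add: Q_def)
  qed
  have gx: "g x = 1" using Qx g_le[of 1 x] g_ge[of 1 x] by (intro antisym) auto
  show thesis
  proof
    show "pairing x (Blinfun g) = 1" using lin gx by (simp add: bounded_linear_Blinfun_apply)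
    show "norm (Blinfun g) \<le> 1"
      using bound lin by (intro norm_blinfun_bound) (auto simp: bounded_linear_Blinfun_apply)
  qed
qed

subsection \<open>Alber's functional\<close>

text \<open>Alber's functional \<open>V(v, w)\<close>, with \<open>\<phi>(v, x) = V(v, J x)\<close>; it needs no duality map.\<close>

definition alber :: "'a::real_normed_vector \<Rightarrow> 'a dual \<Rightarrow> real"
  where "alber v w = (norm v)\<^sup>2 - 2 * pairing v w + (norm w)\<^sup>2"

lemma pairing_le: "pairing v w \<le> norm v * norm w"
  using norm_blinfun[of w v] by (simp add: mult.commute abs_le_iff)

lemma alber_ge: "(norm v - norm w)\<^sup>2 \<le> alber v w"
  using pairing_le[where v = v and w = w] by (simp add: alber_def power2_diff)

lemma alber_nonneg: "0 \<le> alber v w"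
  using alber_ge[of v w] by (meson order_trans zero_le_power2)

lemma norm_le_alber:
  assumes "alber v w \<le> K"
  shows "norm v \<le> norm w + sqrt K" "norm w \<le> norm v + sqrt K"
proof -
  have "(norm v - norm w)\<^sup>2 \<le> K" using alber_ge[of v w] assms by linarith
  then have "\<bar>norm v - norm w\<bar> \<le> sqrt K" using real_sqrt_le_mono by fastforce
  then show "norm v \<le> norm w + sqrt K" "norm w \<le> norm v + sqrt K" by auto
qed

lemma tendsto_alber [tendsto_intros]:
  "(g \<longlongrightarrow> v) F \<Longrightarrow> (h \<longlongrightarrow> w) F \<Longrightarrow> ((\<lambda>t. alber (g t) (h t)) \<longlongrightarrow> alber v w) F"
  unfolding alber_def by (intro tendsto_intros)

text \<open>The pairing is affine in the dual variable and the squared norm is convex. Jensen's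
  inequality for the averaged iterate rests on this.\<close>

lemma convex_on_alber: "convex_on UNIV (alber v)"
proof (rule convex_onI)
  fix t :: real and w w' :: "'a dual" assume t: "0 < t" "t < 1"
  have "norm ((1 - t) *\<^sub>R w + t *\<^sub>R w') \<le> (1 - t) * norm w + t * norm w'"
    using t norm_triangle_ineq[of "(1 - t) *\<^sub>R w" "t *\<^sub>R w'"] by simp
  then have "(norm ((1 - t) *\<^sub>R w + t *\<^sub>R w'))\<^sup>2 \<le> ((1 - t) * norm w + t * norm w')\<^sup>2"
    by (intro power_mono) auto
  moreover have "((1 - t) * norm w + t * norm w')\<^sup>2 
      = (1 - t) * (norm w)\<^sup>2 + t * (norm w')\<^sup>2 - (1 - t) * t * (norm w - norm w')\<^sup>2"
    by (simp add: power2_eq_square algebra_simps)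
  moreover have "0 \<le> (1 - t) * t * (norm w - norm w')\<^sup>2" using t by simp
  ultimately have "(norm ((1 - t) *\<^sub>R w + t *\<^sub>R w'))\<^sup>2 \<le> (1 - t) * (norm w)\<^sup>2 + t * (norm w')\<^sup>2"
    by linarith
  then show "alber v ((1 - t) *\<^sub>R w + t *\<^sub>R w') \<le> (1 - t) * alber v w + t * alber v w'"
    by (simp add: alber_def blinfun.bilinear_simps algebra_simps)
qed simp

text \<open>The pairing is affine in the first argument, so the midpoint gain of the squared norm
  survives unchanged, uniformly in \<open>w\<close>.\<close>

lemma alber_midpoint:
  assumes "uniformly_convex_space TYPE('a::real_normed_vector)" and "\<epsilon> > 0"
  obtains \<delta> where "\<delta> > 0"
    "\<And>(x :: 'a) y w. norm x \<le> R \<Longrightarrow> norm y \<le> R \<Longrightarrow> norm (x - y) \<ge> \<epsilon> \<Longrightarrow>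
      alber ((1/2) *\<^sub>R (x + y)) w \<le> (alber x w + alber y w) / 2 - \<delta>"
proof -
  obtain \<delta> where \<delta>: "\<delta> > 0"
    "\<And>x y :: 'a. norm x \<le> R \<Longrightarrow> norm y \<le> R \<Longrightarrow> norm (x - y) \<ge> \<epsilon> \<Longrightarrow>
      (norm ((1/2) *\<^sub>R (x + y)))\<^sup>2 \<le> ((norm x)\<^sup>2 + (norm y)\<^sup>2) / 2 - \<delta>"
    using uniformly_convex_norm_square[OF assms] by metis
  show thesis
  proof
    fix x y :: 'a and w assume *: "norm x \<le> R" "norm y \<le> R" "norm (x - y) \<ge> \<epsilon>"
    have "pairing ((1/2) *\<^sub>R (x + y)) w = (pairing x w + pairing y w) / 2"
      by (simp add: blinfun.bilinear_simps)
    then show "alber ((1/2) *\<^sub>R (x + y)) w \<le> (alber x w + alber y w) / 2 - \<delta>"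
      using \<delta>(2)[OF *] unfolding alber_def by argo
  qed fact
qed

text \<open>Midpoints of distant terms would fall below the lower bounds \<open>l\<close>. One
  statement covers minimizing sequences, with \<open>l\<close> constant, and projections onto
  decreasing sets, with \<open>l n\<close> the value at \<open>v n\<close>.\<close>

lemma alber_Cauchy:
  fixes v :: "nat \<Rightarrow> 'a::real_normed_vector"
  assumes uc: "uniformly_convex_space TYPE('a)"
    and lim: "(\<lambda>n. alber (v n) w) \<longlonglongrightarrow> d" "l \<longlonglongrightarrow> d"
    and mid: "\<And>m n. n \<le> m \<Longrightarrow> l n \<le> alber ((1/2) *\<^sub>R (v n + v m)) w"
  shows "Cauchy v"
proof (rule metric_CauchyI)
  fix \<epsilon> :: real assume "\<epsilon> > 0"
  have "Bseq (\<lambda>n. alber (v n) w)" using lim(1) convergentI convergent_imp_Bseq by blast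
  then obtain K where "\<forall>n. norm (alber (v n) w) \<le> K" unfolding Bseq_def by blast
  then have K: "alber (v n) w \<le> K" for n by (auto simp: abs_le_iff)
  define R where "R = norm w + sqrt K"
  have R: "norm (v n) \<le> R" for n using norm_le_alber(1)[OF K] by (simp add: R_def)
  obtain \<delta> where \<delta>: "\<delta> > 0"
    "\<And>(x :: 'a) y. norm x \<le> R \<Longrightarrow> norm y \<le> R \<Longrightarrow> norm (x - y) \<ge> \<epsilon> \<Longrightarrow>
      alber ((1/2) *\<^sub>R (x + y)) w \<le> (alber x w + alber y w) / 2 - \<delta>"
    using alber_midpoint[OF uc \<open>\<epsilon> > 0\<close>] by metis
  \<comment> \<open>A slack of \<open>\<delta>/2\<close> on each side is exactly what the midpoint
    gain \<open>\<delta>\<close> beats.\<close>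
  have "\<forall>\<^sub>F n in sequentially. alber (v n) w < d + \<delta>/2" "\<forall>\<^sub>F n in sequentially. d - \<delta>/2 < l n"
    using order_tendstoD[OF lim(1)] order_tendstoD[OF lim(2)] \<delta>(1) by auto
  then have "\<forall>\<^sub>F n in sequentially. alber (v n) w < d + \<delta>/2 \<and> d - \<delta>/2 < l n"
    by (rule eventually_conj)
  then obtain N where N: "\<And>n. n \<ge> N \<Longrightarrow> alber (v n) w < d + \<delta>/2 \<and> d - \<delta>/2 < l n"
    unfolding eventually_sequentially by blast
  have close: "dist (v n) (v m) < \<epsilon>" if "n \<ge> N" "n \<le> m" for m n
  proof (rule ccontr)
    assume "\<not> dist (v n) (v m) < \<epsilon>"
    then have "alber ((1/2) *\<^sub>R (v n + v m)) w \<le> (alber (v n) w + alber (v m) w) / 2 - \<delta>"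
      using \<delta>(2) R by (simp add: dist_norm)
    moreover have "m \<ge> N" using that by simp
    ultimately show False using N[of n] N[of m] mid[of n m] that by argo
  qed
  have "dist (v m) (v n) < \<epsilon>" if "m \<ge> N" "n \<ge> N" for m n
    using close[of m n] close[of n m] that by (cases "m \<le> n") (auto simp: dist_commute)
  then show "\<exists>N. \<forall>m\<ge>N. \<forall>n\<ge>N. dist (v m) (v n) < \<epsilon>" by blast
qed

lemma convex_midpoint: "convex D \<Longrightarrow> x \<in> D \<Longrightarrow> y \<in> D \<Longrightarrow> (1/2) *\<^sub>R (x + y) \<in> D"
  using convexD[of D x y "1/2" "1/2"] by (simp add: scaleR_add_right)

text \<open>Minimizing sequences are Cauchy, so completeness does the work of weak compactness. The
  case \<open>D = UNIV\<close> yields surjectivity of the duality map, the general case the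
  generalized projection.\<close>

lemma alber_minimizer_exists:
  fixes D :: "'a::banach set"
  assumes uc: "uniformly_convex_space TYPE('a)" and D: "closed D" "convex D" "D \<noteq> {}"
  obtains z where "z \<in> D" "\<And>v. v \<in> D \<Longrightarrow> alber z w \<le> alber v w"
proof -
  define d where "d = (INF v\<in>D. alber v w)"
  have bdd: "bdd_below ((\<lambda>v. alber v w) ` D)" using alber_nonneg by (intro bdd_belowI[of _ 0]) auto
  have d_le: "d \<le> alber v w" if "v \<in> D" for v unfolding d_def by (rule cINF_lower[OF bdd that])
  have "\<exists>v\<in>D. alber v w < d + 1 / real (Suc n)" for n
    using cINF_less_iff[OF D(3) bdd, of "d + 1 / real (Suc n)"] by (simp add: d_def)
  then obtain v where v: "\<And>n. v n \<in> D" "\<And>n. alber (v n) w < d + 1 / real (Suc n)" by metis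
  have lim: "(\<lambda>n. alber (v n) w) \<longlonglongrightarrow> d"
  proof (rule tendsto_sandwich)
    show "\<forall>\<^sub>F n in sequentially. d \<le> alber (v n) w"
      using v(1) d_le by (intro always_eventually) blast
    show "\<forall>\<^sub>F n in sequentially. alber (v n) w \<le> d + 1 / real (Suc n)"
      using v(2) less_imp_le by (intro always_eventually) blast
    show "(\<lambda>n. d + 1 / real (Suc n)) \<longlonglongrightarrow> d"
      using tendsto_add[OF tendsto_const LIMSEQ_inverse_real_of_nat, of d] by (simp add: inverse_eq_divide)
  qed simp
  have "Cauchy v"
    using uc lim tendsto_const by (rule alber_Cauchy) (use d_le convex_midpoint D(2) v(1) in blast)
  then obtain z where z: "v \<longlonglongrightarrow> z" using Cauchy_convergent convergent_def by blast
  then have "(\<lambda>n. alber (v n) w) \<longlonglongrightarrow> alber z w" by (intro tendsto_intros)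
  then have "alber z w = d" using lim LIMSEQ_unique by blast
  then show thesis using that[of z] d_le closed_sequentially[OF D(1) v(1) z] by simp
qed

lemma alber_minimizer_unique:
  fixes D :: "'a::real_normed_vector set"
  assumes uc: "uniformly_convex_space TYPE('a)" and D: "convex D" and "z \<in> D" "z' \<in> D"
    and "\<And>v. v \<in> D \<Longrightarrow> alber z w \<le> alber v w" "alber z' w \<le> alber z w"
  shows "z = z'"
proof (rule ccontr)
  assume "z \<noteq> z'"
  then have "norm (z - z') > 0" by simp
  then obtain \<delta> where \<delta>: "\<delta> > 0"
    "\<And>(x :: 'a) y w. norm x \<le> max (norm z) (norm z') \<Longrightarrow> norm y \<le> max (norm z) (norm z') \<Longrightarrow>
      norm (x - y) \<ge> norm (z - z') \<Longrightarrow> alber ((1/2) *\<^sub>R (x + y)) w \<le> (alber x w + alber y w) / 2 - \<delta>"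
    using alber_midpoint[OF uc] by metis
  from \<delta>(2)[of z z' w] have "alber ((1/2) *\<^sub>R (z + z')) w \<le> (alber z w + alber z' w) / 2 - \<delta>" by simp
  moreover have "alber z w \<le> alber ((1/2) *\<^sub>R (z + z')) w"
    using assms by (blast intro: convex_midpoint)
  ultimately show False using assms(6) \<delta>(1) by argo
qed

subsection \<open>Equilibrium bifunctions\<close>

text \<open>The bounds \<open>c n\<close> stand in for the values \<open>g (u n)\<close>, of which
  only upper estimates are available in the application.\<close>

lemma lsc_on_sequentially:
  assumes "lsc_on S g" and u: "\<And>n. u n \<in> S" "l \<in> S" "u \<longlonglongrightarrow> (l::'b::t1_space)" 
    and c: "c \<longlonglongrightarrow> d" "\<And>n. g (u n) \<le> c n"
  shows "g l \<le> d"
proof (rule ccontr)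
  assume "\<not> g l \<le> d"
  then obtain e where e: "d < e" "e < g l" using dense not_le by metis
  have "ereal e < Liminf (at l within S) (\<lambda>y. ereal (g y))"
    using assms(1) u(2) e unfolding lsc_on_def by (metis less_ereal.simps(1) less_le_trans)
  then have "\<forall>\<^sub>F y in at l within S. e < g y" using less_LiminfD by fastforce
  then obtain U where U: "open U" "l \<in> U" "\<And>y. y \<in> U \<Longrightarrow> y \<in> S \<Longrightarrow> y \<noteq> l \<Longrightarrow> e < g y"
    unfolding eventually_at_topological by blast
  have "\<forall>\<^sub>F n in sequentially. u n \<in> U" using topological_tendstoD[OF u(3) U(1,2)] .
  moreover have "\<forall>\<^sub>F n in sequentially. c n < e" using order_tendstoD(2)[OF c(1) e(1)] .
  ultimately have "\<forall>\<^sub>F n in sequentially. u n \<in> U \<and> c n < e" by (rule eventually_conj)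
  then obtain n where "u n \<in> U" "c n < e" unfolding eventually_sequentially by blast
  \<comment> \<open>\<open>Liminf\<close> at \<open>l\<close> ignores the point \<open>l\<close>
    itself, so the case \<open>u n = l\<close> is separate.\<close>
  then show False using U(3)[of "u n"] u(1)[of n] c(2)[of n] e by (cases "u n = l") auto
qed

text \<open>Minty's argument: at points \<open>w\<close> of the segment from \<open>l\<close> to
  \<open>y\<close>, convexity, \<open>f w w = 0\<close> and the dual inequality force
  \<open>f w y \<ge> 0\<close>; (A3) then lets \<open>w\<close> tend to \<open>l\<close>.\<close>

lemma equilibrium_bifunction_Minty:
  assumes f: "equilibrium_bifunction K f" and K: "convex K" and "l \<in> K" "y \<in> K"
    and dual: "\<And>w. w \<in> K \<Longrightarrow> f w l \<le> 0"
  shows "f l y \<ge> 0"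
proof -
  have "f (t *\<^sub>R y + (1 - t) *\<^sub>R l) y \<ge> 0" if t: "0 < t" "t < 1" for t
  proof -
    define w where "w = t *\<^sub>R y + (1 - t) *\<^sub>R l"
    have wK: "w \<in> K" unfolding w_def using K assms(3,4) t by (intro convexD) auto
    then have "convex_on K (f w)" "f w w = 0" using f by (auto simp: equilibrium_bifunction_def)
    then have "f w w \<le> (1 - t) * f w l + t * f w y"
      using convex_onD[of K "f w" t l y] assms(3,4) t by (simp add: w_def add.commute)
    moreover have "(1 - t) * f w l \<le> 0" using dual[OF wK] t by (simp add: mult_nonneg_nonpos)
    ultimately have "0 \<le> t * f w y" using \<open>f w w = 0\<close> by linarith
    then show ?thesis using t by (simp add: w_def zero_le_mult_iff)
  qed
  then have "\<forall>\<^sub>F t in at_right 0. 0 \<le> ereal (f (t *\<^sub>R y + (1 - t) *\<^sub>R l) y)"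
    unfolding eventually_at_right_field by (auto intro!: exI[of _ 1])
  then have "0 \<le> Limsup (at_right 0) (\<lambda>t. ereal (f (t *\<^sub>R y + (1 - t) *\<^sub>R l) y))"
    by (intro le_Limsup) auto
  also have "\<dots> \<le> ereal (f l y)" using f assms(3,4) unfolding equilibrium_bifunction_def by blast
  finally show ?thesis by simp
qed

subsection \<open>The duality map and generalized projections\<close>

locale smooth_convex_space =
  fixes E :: "'a::banach itself"
  assumes us: "uniformly_smooth_space TYPE('a)" and uc: "uniformly_convex_space TYPE('a)"
begin

abbreviation J :: "'a \<Rightarrow> 'a dual" where "J \<equiv> duality_map"
abbreviation Ji :: "'a dual \<Rightarrow> 'a" where "Ji \<equiv> duality_map_inv"

lemma support_functional_unique:
  fixes x :: 'a
  assumes "norm x = 1" "norm v \<le> 1" "norm w \<le> 1" "pairing x v = 1" "pairing x w = 1"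
  shows "v = w"
proof -
  have "norm (v - w) \<le> e" if e: "e > 0" for e
  proof -
    obtain \<eta> where "\<eta> > 0"
      "\<And>(x::'a) v w. norm x = 1 \<Longrightarrow> norm v \<le> 1 \<Longrightarrow> norm w \<le> 1 \<Longrightarrow>
        pairing x v \<ge> 1 - \<eta> \<Longrightarrow> pairing x w \<ge> 1 - \<eta> \<Longrightarrow> norm (v - w) \<le> e"
      using uniformly_smooth_support_functionals[OF us e] by metis
    then show ?thesis using assms by simp
  qed
  then have "norm (v - w) \<le> 0" by (meson dense_ge)
  then show ?thesis by simp
qed

text \<open>Existence comes from rescaling a support functional at the normalized vector, uniqueness
  from smoothness. This justifies the definite description in \<open>duality_map\<close>.\<close>

lemma duality_map_ex1: "\<exists>!w. pairing x w = norm x * norm w \<and> norm w = norm (x::'a)"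
proof (cases "x = 0")
  case True
  then show ?thesis by (auto simp: blinfun.zero_right)
next
  case False
  then have nx: "norm x > 0" by simp
  define e where "e = (1 / norm x) *\<^sub>R x"
  have e: "norm e = 1" "x = norm x *\<^sub>R e" using False by (auto simp: e_def)
  obtain g where g: "pairing e g = 1" "norm g \<le> 1" using uniformly_smooth_support_exists[OF us e(1)] .
  have "norm g \<ge> 1" using pairing_le[where v = e and w = g] g e by simp
  then have g1: "norm g = 1" using g by simp
  have xg: "pairing x g = norm x" using g by (subst e(2)) (simp add: blinfun.scaleR_right)
  show ?thesis
  proof (intro ex1I conjI)
    show "norm (norm x *\<^sub>R g) = norm x" using g1 by simp
    show "pairing x (norm x *\<^sub>R g) = norm x * norm (norm x *\<^sub>R g)"
      using g1 xg by (simp add: blinfun.scaleR_left)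
  next
    fix w assume w: "pairing x w = norm x * norm w \<and> norm w = norm x"
    have "pairing e ((1 / norm x) *\<^sub>R w) = 1"
      using w False by (simp add: e_def blinfun.bilinear_simps)
    then have "(1 / norm x) *\<^sub>R w = g"
      using support_functional_unique[OF e(1)] g w by simp
    then show "w = norm x *\<^sub>R g" using False by (simp flip: \<open>(1 / norm x) *\<^sub>R w = g\<close>)
  qed
qed

lemma pairing_duality_map: "pairing x (J x) = (norm x)\<^sup>2"
  and norm_duality_map: "norm (J x) = norm x"
  using theI'[OF duality_map_ex1, of x] unfolding duality_map_def by (auto simp: power2_eq_square)

lemma duality_map_eqI: "pairing x w = norm x * norm w \<Longrightarrow> norm w = norm x \<Longrightarrow> J x = w"
  unfolding duality_map_def by (rule the1_equality[OF duality_map_ex1]) simp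

lemma lyapunov_alber: "lyapunov v x = alber v (J x)"
  by (simp add: lyapunov_def alber_def norm_duality_map)

lemma lyapunov_nonneg: "0 \<le> lyapunov (v::'a) x"
  by (simp add: lyapunov_alber alber_nonneg)

lemma lyapunov_self: "lyapunov (x::'a) x = 0"
  by (simp add: lyapunov_def pairing_duality_map)

text \<open>Each resolvent estimate follows from this identity once the pairing is shown to be
  nonnegative.\<close>

lemma lyapunov_three_point:
  "lyapunov p (x::'a) = lyapunov p z + lyapunov z x + 2 * pairing (p - z) (J z - J x)"
  by (simp add: lyapunov_def blinfun.bilinear_simps pairing_duality_map)

text \<open>Midpoint convexity and \<open>\<langle>x + y, J y\<rangle> \<le> \<parallel>x + y\<parallel> \<parallel>y\<parallel>\<close> give
  \<open>\<phi>(x, y) \<ge> \<parallel>x\<parallel>\<^sup>2 + \<parallel>y\<parallel>\<^sup>2 - 2 \<parallel>(x + y) / 2\<parallel>\<^sup>2\<close>.\<close>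

lemma lyapunov_bounded_below:
  assumes "\<epsilon> > 0"
  obtains \<delta> where "\<delta> > 0"
    "\<And>x y :: 'a. norm x \<le> R \<Longrightarrow> norm y \<le> R \<Longrightarrow> norm (x - y) \<ge> \<epsilon> \<Longrightarrow> lyapunov x y \<ge> \<delta>"
proof -
  obtain \<delta> where \<delta>: "\<delta> > 0"
    "\<And>x y :: 'a. norm x \<le> R \<Longrightarrow> norm y \<le> R \<Longrightarrow> norm (x - y) \<ge> \<epsilon> \<Longrightarrow>
      (norm ((1/2) *\<^sub>R (x + y)))\<^sup>2 \<le> ((norm x)\<^sup>2 + (norm y)\<^sup>2) / 2 - \<delta>"
    using uniformly_convex_norm_square[OF uc assms] by metis
  show thesis
  proof
    fix x y :: 'a assume *: "norm x \<le> R" "norm y \<le> R" "norm (x - y) \<ge> \<epsilon>"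
    define m where "m = norm ((1/2) *\<^sub>R (x + y))"
    have "pairing (x + y) (J y) \<le> (2 * m) * norm y"
      using pairing_le[where v = "x + y" and w = "J y"] by (simp add: m_def norm_duality_map)
    also have "\<dots> \<le> m\<^sup>2 + (norm y)\<^sup>2" using sum_squares_bound[of m "norm y"] by simp
    finally have "pairing x (J y) \<le> m\<^sup>2" by (simp add: blinfun.add_right pairing_duality_map)
    moreover have "m\<^sup>2 \<le> ((norm x)\<^sup>2 + (norm y)\<^sup>2) / 2 - \<delta>" using \<delta>(2)[OF *] by (simp add: m_def)
    ultimately show "lyapunov x y \<ge> \<delta>" using \<delta>(1) unfolding lyapunov_def by argo
  qed fact
qed

text \<open>Boundedness of one sequence passes to the other through \<open>norm_le_alber\<close>,
  and on a ball a distance of \<open>\<epsilon>\<close> keeps the functional away from zero.\<close>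

lemma lyapunov_tendsto_zero_imp:
  fixes v w :: "nat \<Rightarrow> 'a"
  assumes lim: "(\<lambda>n. lyapunov (v n) (w n)) \<longlonglongrightarrow> 0" and bdd: "Bseq v \<or> Bseq w"
  shows "(\<lambda>n. v n - w n) \<longlonglongrightarrow> 0"
proof (rule tendstoI)
  fix \<epsilon> :: real assume "\<epsilon> > 0"
  have "Bseq (\<lambda>n. lyapunov (v n) (w n))" using lim convergentI convergent_imp_Bseq by blast
  then obtain K where K0: "\<forall>n. norm (lyapunov (v n) (w n)) \<le> K" unfolding Bseq_def by blast
  have K: "alber (v n) (J (w n)) \<le> K" for n
    using K0 by (auto simp: abs_le_iff lyapunov_alber)
  from bdd obtain R0 where "(\<forall>n. norm (v n) \<le> R0) \<or> (\<forall>n. norm (w n) \<le> R0)"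
    unfolding Bseq_def by blast
  moreover have "0 \<le> sqrt K" using K[of 0] alber_nonneg order_trans real_sqrt_ge_zero by blast
  ultimately have R: "norm (v n) \<le> R0 + sqrt K" "norm (w n) \<le> R0 + sqrt K" for n
    using norm_le_alber[OF K[of n]] by (auto simp: norm_duality_map) (smt (verit))+
  obtain \<delta> where \<delta>: "\<delta> > 0"
    "\<And>x y :: 'a. norm x \<le> R0 + sqrt K \<Longrightarrow> norm y \<le> R0 + sqrt K \<Longrightarrow> norm (x - y) \<ge> \<epsilon> \<Longrightarrow> lyapunov x y \<ge> \<delta>"
    using lyapunov_bounded_below[OF \<open>\<epsilon> > 0\<close>] by metis
  have "\<forall>\<^sub>F n in sequentially. lyapunov (v n) (w n) < \<delta>" using order_tendstoD(2)[OF lim \<delta>(1)] .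
  then show "\<forall>\<^sub>F n in sequentially. dist (v n - w n) 0 < \<epsilon>"
  proof eventually_elim
    case (elim n)
    then show ?case using \<delta>(2)[OF R(1)[of n] R(2)[of n]] by (cases "norm (v n - w n) \<ge> \<epsilon>") (auto simp: dist_norm)
  qed
qed

lemma lyapunov_eq_0D: "lyapunov (v::'a) x = 0 \<Longrightarrow> v = x"
  using lyapunov_tendsto_zero_imp[of "\<lambda>_. v" "\<lambda>_. x"] by (auto simp: LIMSEQ_const_iff intro: BseqI'[of _ "norm v"])

text \<open>If \<open>J x = J y\<close>, then
  \<open>lyapunov x y = lyapunov x x = 0\<close>.\<close>

lemma duality_map_inject: "J x = J y \<Longrightarrow> x = y"
  using lyapunov_self[of x] by (intro lyapunov_eq_0D) (simp add: lyapunov_alber)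

text \<open>A minimizer \<open>b\<close> of \<open>\<parallel>v\<parallel>\<^sup>2 - 2 \<langle>v, w\<rangle>\<close> satisfies \<open>J b = w\<close>, since \<open>w\<close> is a subgradient of
  \<open>\<parallel>v\<parallel>\<^sup>2 / 2\<close> at \<open>b\<close>.\<close>

lemma duality_map_surj: "\<exists>b. J b = w"
proof -
  obtain b :: 'a where b: "\<And>v. alber b w \<le> alber v w"
    using alber_minimizer_exists[OF uc, of UNIV w] by auto
  have opt: "2 * t * pairing v w \<le> (norm (b + t *\<^sub>R v))\<^sup>2 - (norm b)\<^sup>2" for t v
    using b[of "b + t *\<^sub>R v"] by (simp add: alber_def blinfun.bilinear_simps)
  \<comment> \<open>Dividing by \<open>t\<close> and letting \<open>t\<close> decrease to 0 removes
    the quadratic term; what remains is a first-order optimality condition.\<close>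
  have lin0: "c \<le> 0" if "\<And>t. t > 0 \<Longrightarrow> t * c \<le> t\<^sup>2 * k" for c k :: real
  proof -
    have "c \<le> t * k" if "t > 0" for t
    proof -
      have "t * c \<le> t * (t * k)" using \<open>\<And>t. t > 0 \<Longrightarrow> t * c \<le> t\<^sup>2 * k\<close>[OF that] by (simp add: power2_eq_square)
      then show ?thesis using that by (metis mult_le_cancel_left_pos)
    qed
    then have "\<forall>\<^sub>F t in at_right 0. c \<le> t * k"
      unfolding eventually_at_right_field by (auto intro: exI[of _ 1])
    moreover have "((\<lambda>t. t * k) \<longlongrightarrow> 0 * k) (at_right 0)" by (intro tendsto_intros)
    ultimately show ?thesis using tendsto_lowerbound[of "\<lambda>t. t * k" "0 * k" "at_right 0" c] by simp
  qed
  have bound: "pairing v w \<le> norm b * norm v" for v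
  proof -
    have "2 * (pairing v w - norm b * norm v) \<le> 0"
    proof (rule lin0)
      fix t :: real assume t: "t > 0"
      have "norm (b + t *\<^sub>R v) \<le> norm b + t * norm v" using norm_triangle_ineq[of b "t *\<^sub>R v"] t by simp
      then have "(norm (b + t *\<^sub>R v))\<^sup>2 \<le> (norm b + t * norm v)\<^sup>2" by (intro power_mono) auto
      then show "t * (2 * (pairing v w - norm b * norm v)) \<le> t\<^sup>2 * (norm v)\<^sup>2"
        using opt[of t v] by (simp add: power2_eq_square algebra_simps)
    qed
    then show ?thesis by simp
  qed
  \<comment> \<open>Shrinking \<open>b\<close> along its own ray gives
    \<open>pairing b w \<ge> (norm b)\<^sup>2\<close>, the converse of \<open>bound\<close> at
    \<open>b\<close>.\<close>
  have "2 * ((norm b)\<^sup>2 - pairing b w) \<le> 0"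
  proof (rule lin0)
    fix t :: real assume t: "t > 0"
    have "b + (- t) *\<^sub>R b = (1 - t) *\<^sub>R b" by (simp add: algebra_simps)
    then have "(norm (b + (- t) *\<^sub>R b))\<^sup>2 = (1 - t)\<^sup>2 * (norm b)\<^sup>2"
      by (simp add: power_mult_distrib)
    then show "t * (2 * ((norm b)\<^sup>2 - pairing b w)) \<le> t\<^sup>2 * (norm b)\<^sup>2"
      using opt[of "- t" b] by (simp add: power2_eq_square algebra_simps)
  qed
  then have bb: "pairing b w = (norm b)\<^sup>2" using bound[of b] by (simp add: power2_eq_square)
  have "norm w \<le> norm b"
  proof (rule norm_blinfun_bound)
    fix v show "norm (pairing v w) \<le> norm b * norm v"
      using bound[of v] bound[of "- v"] by (simp add: abs_le_iff blinfun.minus_right)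
  qed simp
  moreover have "norm b * norm b \<le> norm b * norm w"
    using pairing_le[where v = b and w = w] bb by (simp add: power2_eq_square)
  then have "norm b \<le> norm w" by (cases "b = 0") auto
  ultimately have "J b = w" using bb by (intro duality_map_eqI) (auto simp: power2_eq_square)
  then show ?thesis ..
qed

lemma bij_duality_map: "bij J"
  using duality_map_inject duality_map_surj by (metis bijI injI surjI surj_def)

lemma duality_map_inverse [simp]: "Ji (J x) = x" "J (Ji w) = w"
  using bij_duality_map by (auto simp: duality_map_inv_def bij_is_inj bij_is_surj surj_f_inv_f)

text \<open>The normalized values \<open>g n\<close> almost norm the direction of \<open>l\<close>,
  so smoothness brings them close to the support functional there; multiplying by the norms recovers
  \<open>J\<close>.\<close>

lemma duality_map_tendsto:
  fixes l :: 'a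
  assumes "v \<longlonglongrightarrow> l"
  shows "(\<lambda>n. J (v n)) \<longlonglongrightarrow> J l"
proof (cases "l = 0")
  case True
  have "norm (J (0::'a)) = 0" by (simp only: norm_duality_map norm_zero)
  then have "J l = 0" using True by simp
  moreover have "(\<lambda>n. norm (J (v n))) \<longlonglongrightarrow> 0"
    using tendsto_norm[OF assms] True by (simp add: norm_duality_map)
  ultimately show ?thesis by (simp add: tendsto_norm_zero_iff)
next
  case False
  define e where "e = (1 / norm l) *\<^sub>R l"
  \<comment> \<open>If \<open>v n = 0\<close>, division by zero gives \<open>g n = 0\<close>; the
    bound by 1 and \<open>norm (v n) *\<^sub>R g n = J (v n)\<close> still hold.\<close>
  define g where "g n = (1 / norm (v n)) *\<^sub>R J (v n)" for n
  define h where "h = (1 / norm l) *\<^sub>R J l"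
  have e: "norm e = 1" "norm h = 1" "pairing e h = 1" using False
    by (auto simp: e_def h_def norm_duality_map pairing_duality_map blinfun.bilinear_simps power2_eq_square)
  have g: "norm (g n) \<le> 1" for n by (simp add: g_def norm_duality_map)
  have lower: "(norm (v n) - norm (l - v n)) / norm l \<le> pairing e (g n)" for n
  proof -
    have "pairing l (g n) = pairing (v n) (g n) + pairing (l - v n) (g n)" by (simp add: blinfun.bilinear_simps)
    moreover have "pairing (v n) (g n) = norm (v n)"
      by (simp add: g_def blinfun.bilinear_simps pairing_duality_map power2_eq_square)
    moreover have "- pairing (l - v n) (g n) \<le> norm (l - v n)"
      using pairing_le[where v = "- (l - v n)" and w = "g n"] mult_left_le[OF g[of n], of "norm (l - v n)"]
      by (simp add: blinfun.bilinear_simps norm_minus_commute)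
    ultimately have "norm (v n) - norm (l - v n) \<le> pairing l (g n)" by linarith
    then have "(norm (v n) - norm (l - v n)) / norm l \<le> pairing l (g n) / norm l"
      by (intro divide_right_mono) auto
    then show ?thesis by (simp add: e_def blinfun.bilinear_simps)
  qed
  have "(\<lambda>n. (norm (v n) - norm (l - v n)) / norm l) \<longlonglongrightarrow> (norm l - norm (l - l)) / norm l"
    using assms False by (intro tendsto_intros) auto
  then have lim: "(\<lambda>n. (norm (v n) - norm (l - v n)) / norm l) \<longlonglongrightarrow> 1" using False by simp
  have "g \<longlonglongrightarrow> h"
  proof (rule tendstoI)
    fix \<epsilon> :: real assume "\<epsilon> > 0"
    then have "\<epsilon> / 2 > 0" by simp
    then obtain \<eta> where \<eta>: "\<eta> > 0"
      "\<And>(x::'a) v w. norm x = 1 \<Longrightarrow> norm v \<le> 1 \<Longrightarrow> norm w \<le> 1 \<Longrightarrow>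
        pairing x v \<ge> 1 - \<eta> \<Longrightarrow> pairing x w \<ge> 1 - \<eta> \<Longrightarrow> norm (v - w) \<le> \<epsilon> / 2"
      using uniformly_smooth_support_functionals[OF us] by metis
    have "\<forall>\<^sub>F n in sequentially. 1 - \<eta> < (norm (v n) - norm (l - v n)) / norm l"
      using \<eta>(1) by (intro order_tendstoD(1)[OF lim]) simp
    then show "\<forall>\<^sub>F n in sequentially. dist (g n) h < \<epsilon>"
    proof eventually_elim
      case (elim n)
      have "norm (g n - h) \<le> \<epsilon> / 2" using \<eta>(1) e lower[of n] elim by (intro \<eta>(2)[OF e(1) g]) auto
      then show ?case using \<open>\<epsilon> > 0\<close> by (simp add: dist_norm)
    qed
  qed
  then have "(\<lambda>n. norm (v n) *\<^sub>R g n) \<longlonglongrightarrow> norm l *\<^sub>R h" using assms by (intro tendsto_intros)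
  moreover have "norm (v n) *\<^sub>R g n = J (v n)" for n
    using norm_duality_map[of "v n"] by (cases "v n = 0") (auto simp: g_def)
  ultimately show ?thesis using False by (simp add: h_def)
qed

text \<open>Here \<open>lyapunov l (Ji (w n))\<close> is \<open>alber l (w n)\<close>, which tends
  to \<open>alber l (J l) = 0\<close> by continuity of \<open>alber\<close>.\<close>

lemma duality_map_inv_tendsto:
  assumes "w \<longlonglongrightarrow> J l"
  shows "(\<lambda>n. Ji (w n)) \<longlonglongrightarrow> l"
proof -
  have "(\<lambda>n. lyapunov l (Ji (w n))) \<longlonglongrightarrow> alber l (J l)"
    unfolding lyapunov_alber using assms by (auto intro!: tendsto_intros)
  then have "(\<lambda>n. lyapunov l (Ji (w n))) \<longlonglongrightarrow> 0"
    using lyapunov_self[of l] by (simp add: lyapunov_alber)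
  then have "(\<lambda>n. l - Ji (w n)) \<longlonglongrightarrow> 0"
    by (rule lyapunov_tendsto_zero_imp) (auto intro: BseqI'[of _ "norm l"])
  then show ?thesis using tendsto_diff[OF tendsto_const[of l]] by fastforce
qed

lemma lyapunov_tendsto:
  assumes "v \<longlonglongrightarrow> l" "w \<longlonglongrightarrow> (m::'a)"
  shows "(\<lambda>n. lyapunov (v n) (w n)) \<longlonglongrightarrow> lyapunov l m"
  unfolding lyapunov_alber using assms by (intro tendsto_intros duality_map_tendsto)

lemma lyapunov_tendsto_zero_limit:
  assumes "(\<lambda>n. lyapunov (v n) (w n)) \<longlonglongrightarrow> 0" and "v \<longlonglongrightarrow> (l::'a) \<or> w \<longlonglongrightarrow> l"
  shows "v \<longlonglongrightarrow> l" "w \<longlonglongrightarrow> l"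
proof -
  have "Bseq v \<or> Bseq w" using assms(2) convergentI convergent_imp_Bseq by blast
  then have *: "(\<lambda>n. v n - w n) \<longlonglongrightarrow> 0" using lyapunov_tendsto_zero_imp assms(1) by blast
  show "v \<longlonglongrightarrow> l" using assms(2) Lim_transform[OF _ *] by auto
  show "w \<longlonglongrightarrow> l" using assms(2) Lim_transform2[OF _ *] by auto
qed

section \<open>Generalized projections onto fixed and onto decreasing sets\<close>

lemma gen_proj:
  fixes D :: "'a set"
  assumes D: "closed D" "convex D" "D \<noteq> {}"
  shows "gen_proj D x \<in> D" "v \<in> D \<Longrightarrow> lyapunov (gen_proj D x) x \<le> lyapunov v x"
proof -
  obtain z where z: "z \<in> D" "\<And>v. v \<in> D \<Longrightarrow> lyapunov z x \<le> lyapunov v x"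
    using alber_minimizer_exists[OF uc D, of "J x"] unfolding lyapunov_alber by metis
  have "is_arg_min (\<lambda>y. lyapunov y x) (\<lambda>y. y \<in> D) z" using z by (auto simp: is_arg_min_linorder)
  moreover have "z' = z" if "is_arg_min (\<lambda>y. lyapunov y x) (\<lambda>y. y \<in> D) z'" for z'
    using that z alber_minimizer_unique[OF uc D(2), of z' z "J x"]
    by (auto simp: is_arg_min_linorder lyapunov_alber)
  ultimately have "gen_proj D x = z" unfolding gen_proj_def by (rule the_equality)
  then show "gen_proj D x \<in> D" "v \<in> D \<Longrightarrow> lyapunov (gen_proj D x) x \<le> lyapunov v x"
    using z by auto
qed

lemma gen_proj_eqI:
  fixes D :: "'a set"
  assumes D: "closed D" "convex D" and z: "z \<in> D" "\<And>v. v \<in> D \<Longrightarrow> lyapunov z x \<le> lyapunov v x"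
  shows "gen_proj D x = z"
proof -
  have "D \<noteq> {}" using z by auto
  note P = gen_proj[OF D this, where x = x]
  show ?thesis
    using alber_minimizer_unique[OF uc D(2) z(1) P(1)] z(2) P(2)[OF z(1)]
    unfolding lyapunov_alber by metis
qed

text \<open>The terms \<open>(norm v)\<^sup>2\<close> cancel, so the condition is affine in
  \<open>v\<close>; the shrinking sets inherit closedness and convexity from it.\<close>

lemma lyapunov_halfspace: "{v. lyapunov v y \<le> lyapunov v (x::'a)} 
    = {v. pairing v (2 *\<^sub>R (J x - J y)) \<le> (norm x)\<^sup>2 - (norm y)\<^sup>2}"
  by (auto simp: lyapunov_def blinfun.bilinear_simps)

lemma closed_lyapunov_le: "closed {v. lyapunov v y \<le> lyapunov v (x::'a)}"
  unfolding lyapunov_halfspace by (intro closed_Collect_le continuous_intros)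

lemma convex_lyapunov_le: "convex {v. lyapunov v y \<le> lyapunov v (x::'a)}"
proof -
  have "convex (blinfun_apply (2 *\<^sub>R (J x - J y)) -` {..(norm x)\<^sup>2 - (norm y)\<^sup>2})"
    by (intro convex_linear_vimage convex_real_interval bounded_linear.linear blinfun.bounded_linear_right)
  then show ?thesis unfolding lyapunov_halfspace by (simp add: vimage_def)
qed

text \<open>The minimal values increase and stay below the value at \<open>p\<close>, hence
  converge. Midpoints of later terms remain in the earlier set, so \<open>alber_Cauchy\<close>
  applies.\<close>

lemma shrinking_projection_convergent:
  fixes D :: "nat \<Rightarrow> 'a set"
  assumes D: "\<And>n. closed (D n)" "\<And>n. convex (D n)" and dec: "decseq D" and p: "\<And>n. p \<in> D n"
  obtains l where "(\<lambda>n. gen_proj (D n) x) \<longlonglongrightarrow> l" "\<And>n. l \<in> D n"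
    "\<And>v. (\<And>n. v \<in> D n) \<Longrightarrow> lyapunov l x \<le> lyapunov v x"
proof -
  define s where "s n = gen_proj (D n) x" for n
  have ne: "D n \<noteq> {}" for n using p[of n] by auto
  note P = gen_proj(1)[OF D ne, where x = x, folded s_def] gen_proj(2)[OF D ne, where x = x, folded s_def]
  have mem: "s m \<in> D n" if "n \<le> m" for m n using P(1) dec that by (auto simp: decseq_def)
  have "incseq (\<lambda>n. lyapunov (s n) x)" using P(2) mem by (auto intro: incseq_SucI)
  moreover have "lyapunov (s n) x \<le> lyapunov p x" for n using P(2) p by blast
  ultimately obtain d where d: "(\<lambda>n. lyapunov (s n) x) \<longlonglongrightarrow> d" using incseq_convergent by metis
  have "Cauchy s"
    using uc d d unfolding lyapunov_alber
  proof (rule alber_Cauchy)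
    fix m n :: nat assume "n \<le> m"
    then have "(1/2) *\<^sub>R (s n + s m) \<in> D n" using mem D(2) by (intro convex_midpoint) auto
    then show "alber (s n) (J x) \<le> alber ((1/2) *\<^sub>R (s n + s m)) (J x)"
      using P(2) unfolding lyapunov_alber by blast
  qed
  then obtain l where l: "s \<longlonglongrightarrow> l" using Cauchy_convergent convergent_def by blast
  show thesis
  proof
    show "(\<lambda>n. gen_proj (D n) x) \<longlonglongrightarrow> l" using l by (simp add: s_def[abs_def])
    show "l \<in> D n" for n
      using D(1) Lim_in_closed_set[OF D(1) _ _ l, of n] mem eventually_sequentiallyI[of n] by fastforce
    fix v assume "\<And>n. v \<in> D n"
    then have "\<And>n. lyapunov (s n) x \<le> lyapunov v x" using P(2) by blast
    then show "lyapunov l x \<le> lyapunov v x"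
      using lyapunov_tendsto[OF l tendsto_const[of x]] LIMSEQ_le_const2 by blast
  qed
qed

subsection \<open>Resolvents\<close>

text \<open>Testing the resolvent relation at \<open>p\<close> and using (A2) with
  \<open>f (J p) (J z) \<ge> 0\<close> makes the pairing in the three-point identity
  nonnegative.\<close>

lemma resolvent_EP_lyapunov:
  assumes f: "equilibrium_bifunction (J ` C) f" and p: "p \<in> EP C f"
    and z: "is_resolvent_EP C f r (x::'a) z" and r: "r > 0"
  shows "lyapunov p z + lyapunov z x \<le> lyapunov p x"
proof -
  have C: "p \<in> C" "z \<in> C" using p z by (auto simp: EP_def is_resolvent_EP_def)
  have "f (J p) (J z) \<ge> 0" using p C by (auto simp: EP_def)
  moreover have "f (J p) (J z) + f (J z) (J p) \<le> 0" using f C by (auto simp: equilibrium_bifunction_def)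
  moreover have "f (J z) (J p) + (1/r) * pairing (p - z) (J z - J x) \<ge> 0"
    using z C by (auto simp: is_resolvent_EP_def)
  ultimately have "(1/r) * pairing (p - z) (J z - J x) \<ge> 0" by linarith
  then show ?thesis using r lyapunov_three_point[of p x z] by (simp add: zero_le_divide_iff)
qed

lemma resolvent_VI_lyapunov:
  assumes A: "monotone_map_on C A" and p: "p \<in> VI C A"
    and z: "is_resolvent_VI C A r (x::'a) z" and r: "r > 0"
  shows "lyapunov p z + lyapunov z x \<le> lyapunov p x"
proof -
  have C: "p \<in> C" "z \<in> C" using p z by (auto simp: VI_def is_resolvent_VI_def)
  have "pairing (z - p) (A p) \<ge> 0" using p C by (auto simp: VI_def)
  moreover have "pairing (p - z) (A p - A z) \<ge> 0" using A C by (auto simp: monotone_map_on_def)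
  moreover have "pairing (p - z) (A z) + (1/r) * pairing (p - z) (J z - J x) \<ge> 0"
    using z C by (auto simp: is_resolvent_VI_def)
  ultimately have "(1/r) * pairing (p - z) (J z - J x) \<ge> 0" by (simp add: blinfun.bilinear_simps)
  then show ?thesis using r lyapunov_three_point[of p x z] by (simp add: zero_le_divide_iff)
qed

text \<open>Monotonicity is used between the graph points \<open>(p, 0)\<close> and
  \<open>(z, (1/r) *\<^sub>R (J x - J z))\<close>.\<close>

lemma resolvent_op_lyapunov:
  assumes M: "monotone_operator M" and p: "p \<in> zeros M"
    and z: "is_resolvent_op M r (x::'a) z" and r: "r > 0"
  shows "lyapunov p z + lyapunov z x \<le> lyapunov p x"
proof -
  have "pairing (p - z) (0 - (1/r) *\<^sub>R (J x - J z)) \<ge> 0"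
    using M p z unfolding monotone_operator_def zeros_def is_resolvent_op_def by blast
  then have "(1/r) * pairing (p - z) (J z - J x) \<ge> 0" by (simp add: blinfun.bilinear_simps diff_divide_distrib)
  then show ?thesis using r lyapunov_three_point[of p x z] by (simp add: zero_le_divide_iff)
qed

text \<open>The lower bound \<open>a\<close> keeps \<open>1 / r n\<close> bounded, so norm
  continuity of \<open>J\<close> suffices.\<close>

lemma resolvent_remainder_tendsto:
  assumes z: "z \<longlonglongrightarrow> l" and x: "x \<longlonglongrightarrow> (l::'a)" and r: "a > 0" "\<And>n. r n \<ge> a"
  shows "(\<lambda>n. (1 / r n) *\<^sub>R (J (z n) - J (x n))) \<longlonglongrightarrow> 0"
proof (rule Lim_null_comparison)
  have "(\<lambda>n. J (z n) - J (x n)) \<longlonglongrightarrow> J l - J l" using z x by (intro tendsto_intros duality_map_tendsto)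
  then have "(\<lambda>n. J (z n) - J (x n)) \<longlonglongrightarrow> 0" by simp
  then show "(\<lambda>n. (1/a) * norm (J (z n) - J (x n))) \<longlonglongrightarrow> 0" by (intro tendsto_mult_right_zero tendsto_norm_zero)
  have "\<bar>1 / r n\<bar> \<le> 1 / a" for n using r(1) r(2)[of n] by (auto simp: field_simps)
  then show "\<forall>\<^sub>F n in sequentially. norm ((1 / r n) *\<^sub>R (J (z n) - J (x n))) \<le> (1/a) * norm (J (z n) - J (x n))"
    by (intro always_eventually allI) (simp only: norm_scaleR mult_right_mono norm_ge_zero)
qed

lemma resolvent_VI_limit:
  assumes C: "closed C" and A: "continuous_on C A" and res: "\<And>n. is_resolvent_VI C A (r n) (x n) (z n)"
    and z: "z \<longlonglongrightarrow> l" and x: "x \<longlonglongrightarrow> (l::'a)" and r: "a > 0" "\<And>n. r n \<ge> a"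
  shows "l \<in> VI C A"
proof -
  have zC: "z n \<in> C" for n using res by (auto simp: is_resolvent_VI_def)
  then have lC: "l \<in> C" using closed_sequentially[OF C] z by blast
  have "pairing (y - l) (A l) \<ge> 0" if "y \<in> C" for y
  proof (rule LIMSEQ_le_const)
    have "(\<lambda>n. A (z n)) \<longlonglongrightarrow> A l" using continuous_on_tendsto_compose[OF A z lC] zC by simp
    then have "(\<lambda>n. pairing (y - z n) (A (z n) + (1 / r n) *\<^sub>R (J (z n) - J (x n)))) \<longlonglongrightarrow> pairing (y - l) (A l + 0)"
      using z by (intro tendsto_intros resolvent_remainder_tendsto[OF z x r])
    then show "(\<lambda>n. pairing (y - z n) (A (z n) + (1 / r n) *\<^sub>R (J (z n) - J (x n)))) \<longlonglongrightarrow> pairing (y - l) (A l)" by simp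
    show "\<exists>N. \<forall>n\<ge>N. 0 \<le> pairing (y - z n) (A (z n) + (1 / r n) *\<^sub>R (J (z n) - J (x n)))"
      using res that unfolding is_resolvent_VI_def by (simp add: blinfun.add_left blinfun.scaleR_left)
  qed
  then show ?thesis using lC by (simp add: VI_def)
qed

text \<open>Monotonicity against a fixed graph point involves no limit of values of
  \<open>M\<close>, so it passes to \<open>l\<close>; maximality concludes.\<close>

lemma resolvent_op_limit:
  assumes M: "maximal_monotone M" and res: "\<And>n. is_resolvent_op M (r n) (x n) (z n)"
    and z: "z \<longlonglongrightarrow> l" and x: "x \<longlonglongrightarrow> (l::'a)" and r: "a > 0" "\<And>n. r n \<ge> a"
  shows "l \<in> zeros M"
proof -
  have mono: "monotone_operator M" using M by (simp add: maximal_monotone_def)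
  have ge: "pairing (w - l) ws \<ge> 0" if "ws \<in> M w" for w ws
  proof (rule LIMSEQ_le_const)
    have "(\<lambda>n. pairing (w - z n) (ws + (1 / r n) *\<^sub>R (J (z n) - J (x n)))) \<longlonglongrightarrow> pairing (w - l) (ws + 0)"
      using z by (intro tendsto_intros resolvent_remainder_tendsto[OF z x r])
    then show "(\<lambda>n. pairing (w - z n) (ws + (1 / r n) *\<^sub>R (J (z n) - J (x n)))) \<longlonglongrightarrow> pairing (w - l) ws" by simp
    have "pairing (w - z n) (ws - (1 / r n) *\<^sub>R (J (x n) - J (z n))) \<ge> 0" for n
      using mono res that unfolding monotone_operator_def is_resolvent_op_def by blast
    then show "\<exists>N. \<forall>n\<ge>N. 0 \<le> pairing (w - z n) (ws + (1 / r n) *\<^sub>R (J (z n) - J (x n)))"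
      by (simp add: algebra_simps)
  qed
  \<comment> \<open>Adjoining \<open>(l, 0)\<close> keeps the graph monotone by \<open>ge\<close>,
    so maximality says that the point was already there.\<close>
  define N where "N = M(l := insert 0 (M l))"
  have "monotone_operator N"
    unfolding monotone_operator_def
  proof (intro allI ballI)
    fix v w vs ws assume vw: "vs \<in> N v" "ws \<in> N w"
    have "vs \<in> M v \<or> v = l \<and> vs = 0" "ws \<in> M w \<or> w = l \<and> ws = 0"
      using vw by (auto simp: N_def split: if_splits)
    then show "pairing (v - w) (vs - ws) \<ge> 0"
      using ge[of vs v] ge[of ws w] mono unfolding monotone_operator_def
      by (auto simp: blinfun.bilinear_simps)
  qed
  moreover have "operator_graph M \<subseteq> operator_graph N" by (auto simp: operator_graph_def N_def)
  ultimately have "operator_graph M = operator_graph N" using M unfolding maximal_monotone_def by blast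
  moreover have "(l, 0) \<in> operator_graph N" by (simp add: operator_graph_def N_def)
  ultimately have "(l, 0) \<in> operator_graph M" by simp
  then show ?thesis by (simp add: operator_graph_def zeros_def)
qed

text \<open>Semicontinuity is available in the second argument of \<open>f\<close>, so (A2) first
  moves \<open>z n\<close> there; Minty's argument then turns the limit inequality around.\<close>

lemma resolvent_EP_limit:
  assumes C: "closed C" "convex (J ` C)" and f: "equilibrium_bifunction (J ` C) f"
    and res: "\<And>n. is_resolvent_EP C f (r n) (x n) (z n)"
    and z: "z \<longlonglongrightarrow> l" and x: "x \<longlonglongrightarrow> (l::'a)" and r: "a > 0" "\<And>n. r n \<ge> a"
  shows "l \<in> EP C f"
proof -
  have zC: "z n \<in> C" for n using res by (auto simp: is_resolvent_EP_def)
  then have lC: "l \<in> C" using closed_sequentially[OF C(1)] z by blast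
  have dual: "f (J y) (J l) \<le> 0" if y: "y \<in> C" for y
  proof (rule lsc_on_sequentially[where g = "f (J y)" and S = "J ` C" and u = "\<lambda>n. J (z n)"])
    show "lsc_on (J ` C) (f (J y))" using f y by (auto simp: equilibrium_bifunction_def)
    have "(\<lambda>n. pairing (y - z n) ((1 / r n) *\<^sub>R (J (z n) - J (x n)))) \<longlonglongrightarrow> pairing (y - l) 0"
      using z by (intro tendsto_intros resolvent_remainder_tendsto[OF z x r])
    then show "(\<lambda>n. pairing (y - z n) ((1 / r n) *\<^sub>R (J (z n) - J (x n)))) \<longlonglongrightarrow> 0" by simp
    fix n
    have "f (J y) (J (z n)) + f (J (z n)) (J y) \<le> 0"
      using f y zC by (auto simp: equilibrium_bifunction_def)
    moreover have "f (J (z n)) (J y) + (1 / r n) * pairing (y - z n) (J (z n) - J (x n)) \<ge> 0"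
      using res y by (auto simp: is_resolvent_EP_def)
    ultimately show "f (J y) (J (z n)) \<le> pairing (y - z n) ((1 / r n) *\<^sub>R (J (z n) - J (x n)))"
      by (simp add: blinfun.scaleR_left)
  qed (use zC lC duality_map_tendsto[OF z] in auto)
  have "f (J l) (J y) \<ge> 0" if "y \<in> C" for y
    using lC that dual by (intro equilibrium_bifunction_Minty[OF f C(2)]) auto
  then show ?thesis using lC by (simp add: EP_def)
qed

subsection \<open>Convergence of the shrinking projection method\<close>

text \<open>In terms of \<open>alber\<close> the maps \<open>J\<close> and \<open>Ji\<close> cancel,
  and Jensen's inequality in the dual variable remains.\<close>

lemma lyapunov_convex_combination:
  assumes "finite I" "\<And>i. i \<in> I \<Longrightarrow> 0 \<le> c i" "sum c I = 1"
  shows "lyapunov p (Ji (\<Sum>i\<in>I. c i *\<^sub>R w i)) \<le> (\<Sum>i\<in>I. c i * lyapunov p (Ji (w i)))"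
proof -
  have "I \<noteq> {}" using assms(3) by auto
  then show ?thesis
    unfolding lyapunov_alber duality_map_inverse
    using assms by (intro convex_on_sum[OF _ _ convex_on_alber]) auto
qed

lemma lyapunov_tendsto_zero_le:
  assumes "\<And>n. lyapunov (v n) (w n :: 'a) \<le> c n" "c \<longlonglongrightarrow> 0"
  shows "(\<lambda>n. lyapunov (v n) (w n)) \<longlonglongrightarrow> 0"
  using assms lyapunov_nonneg by (intro Lim_null_comparison[OF _ assms(2)]) simp

end

theorem theorem3p2:
  fixes C :: "'a::banach set"
    and f :: "nat \<Rightarrow> 'a dual \<Rightarrow> 'a dual \<Rightarrow> real"
    and A :: "nat \<Rightarrow> 'a \<Rightarrow> 'a dual"
    and M :: "nat \<Rightarrow> 'a \<Rightarrow> 'a dual set"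
    and T :: "nat \<Rightarrow> 'a \<Rightarrow> 'a dual"
    and \<Gamma> :: "('a \<Rightarrow> 'a dual) set"
    and \<sigma> \<tau> \<rho> :: "nat \<Rightarrow> nat"
    and B :: "'a set"
    and r :: "nat \<Rightarrow> real" and a :: real and \<alpha> :: "nat \<Rightarrow> real"
    and x :: 'a and xs z u q y :: "nat \<Rightarrow> 'a" and Cs :: "nat \<Rightarrow> 'a set"
  assumes "uniformly_smooth_space TYPE('a)" and "uniformly_convex_space TYPE('a)"
    and "C \<noteq> {}" and "closed C" and "convex C"
    and "closed (duality_map ` C)" and "convex (duality_map ` C)"
    and "\<And>i. i \<ge> 1 \<Longrightarrow> equilibrium_bifunction (duality_map ` C) (f i)"
    and "\<And>j. j \<ge> 1 \<Longrightarrow> continuous_on C (A j) \<and> monotone_map_on C (A j)"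
    and "\<And>k. k \<ge> 1 \<Longrightarrow> maximal_monotone (M k)"
    and resolvents_defined:
      "\<And>i s v. i \<ge> 1 \<Longrightarrow> s > 0 \<Longrightarrow> \<exists>!w. is_resolvent_EP C (f i) s v w"
      "\<And>j s v. j \<ge> 1 \<Longrightarrow> s > 0 \<Longrightarrow> \<exists>!w. is_resolvent_VI C (A j) s v w"
      "\<And>k s v. k \<ge> 1 \<Longrightarrow> s > 0 \<Longrightarrow> \<exists>!w. is_resolvent_op (M k) s v w"
    and "\<And>k s. k \<ge> 1 \<Longrightarrow> s > 0 \<Longrightarrow> resolvent_op (M k) s ` C \<subseteq> C"
    and "\<And>n. n \<ge> 1 \<Longrightarrow> gen_Jstar_nonexpansive C (T n)"
    and "\<And>S. S \<in> \<Gamma> \<Longrightarrow> Jstar_closed C S \<and> gen_Jstar_nonexpansive C S"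
    and "(\<Inter>n\<in>{1..}. F_J C (T n)) = F_J_family C \<Gamma>" and "F_J_family C \<Gamma> \<noteq> {}"
    and "\<sigma> \<in> {1..} \<rightarrow> {1..}" and "\<tau> \<in> {1..} \<rightarrow> {1..}" and "\<rho> \<in> {1..} \<rightarrow> {1..}"
    and "\<And>m. m \<ge> 1 \<Longrightarrow> infinite {n. n \<ge> 1 \<and> \<sigma> n = m}"
    and "\<And>m. m \<ge> 1 \<Longrightarrow> infinite {n. n \<ge> 1 \<and> \<tau> n = m}"
    and "\<And>m. m \<ge> 1 \<Longrightarrow> infinite {n. n \<ge> 1 \<and> \<rho> n = m}"
    and "B = F_J_family C \<Gamma> \<inter> (\<Inter>i\<in>{1..}. EP C (f i)) \<inter> (\<Inter>j\<in>{1..}. VI C (A j))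
          \<inter> (\<Inter>k\<in>{1..}. zeros (M k))"
    and "B \<noteq> {}" and "closed B" and "convex B"
    and "a > 0" and "\<And>n. n \<ge> 1 \<Longrightarrow> r n \<ge> a"
    and "\<And>i. i \<in> {1..5} \<Longrightarrow> \<alpha> i \<in> {0<..<1}" and "(\<Sum>i=1..5. \<alpha> i) = 1"
    and "x \<in> C" and "xs 1 = x" and "Cs 1 = C"
    and "\<And>n. n \<ge> 1 \<Longrightarrow> z n = resolvent_EP C (f (\<sigma> n)) (r n) (xs n)"
    and "\<And>n. n \<ge> 1 \<Longrightarrow> u n = resolvent_VI C (A (\<tau> n)) (r n) (xs n)"
    and "\<And>n. n \<ge> 1 \<Longrightarrow> q n = resolvent_op (M (\<rho> n)) (r n) (xs n)"
    and "\<And>n. n \<ge> 1 \<Longrightarrow> y n = duality_map_inv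
          (\<alpha> 1 *\<^sub>R duality_map (xs n) + \<alpha> 2 *\<^sub>R duality_map (z n) + \<alpha> 3 *\<^sub>R duality_map (u n)
            + \<alpha> 4 *\<^sub>R duality_map (q n) + \<alpha> 5 *\<^sub>R T n (q n))"
    and "\<And>n. n \<ge> 1 \<Longrightarrow> Cs (Suc n) = {v \<in> Cs n. lyapunov v (y n) \<le> lyapunov v (xs n)}"
    and "\<And>n. n \<ge> 1 \<Longrightarrow> xs (Suc n) = gen_proj (Cs (Suc n)) x"
    and "NST_condition C T \<Gamma>"
  shows "xs \<longlonglongrightarrow> gen_proj B x"
proof -
  interpret smooth_convex_space "TYPE('a)" by unfold_locales fact+
  note C = \<open>closed C\<close> \<open>convex C\<close>
  note f = assms(8) and A = assms(9) and M = assms(10)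
  note T = assms(15) and \<Gamma> = assms(16) and F_eq = assms(17) and resC = assms(14)
  note maps = assms(19-21) and inf = assms(22-24) and start = assms(33-35)
  note z_def = assms(36) and u_def = assms(37) and q_def = assms(38) and y_def = assms(39)
    and Cs_def = assms(40) and xs_def = assms(41)
  note B_def = \<open>B = F_J_family C \<Gamma> \<inter> _ \<inter> _ \<inter> _\<close>
  note r = \<open>a > 0\<close> \<open>\<And>n. n \<ge> 1 \<Longrightarrow> r n \<ge> a\<close>
  have sum5: "(\<Sum>i=1..5. g i) = g 1 + g 2 + g 3 + g 4 + g 5" for g :: "nat \<Rightarrow> 'c::comm_monoid_add"
    by (simp add: eval_nat_numeral sum.atLeast_Suc_atMost add_ac)
  have \<alpha>: "\<alpha> 1 > 0" "\<alpha> 2 > 0" "\<alpha> 3 > 0" "\<alpha> 4 > 0" "\<alpha> 5 > 0" "\<alpha> 1 + \<alpha> 2 + \<alpha> 3 + \<alpha> 4 + \<alpha> 5 = 1"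
    using \<open>\<And>i. i \<in> {1..5} \<Longrightarrow> \<alpha> i \<in> {0<..<1}\<close> \<open>(\<Sum>i=1..5. \<alpha> i) = 1\<close> unfolding sum5 by auto
  have pos: "\<sigma> n \<ge> 1" "\<tau> n \<ge> 1" "\<rho> n \<ge> 1" "r n > 0" if "n \<ge> 1" for n
    using that maps r(1) r(2)[OF that] by (auto simp: Pi_iff)
  have z: "is_resolvent_EP C (f (\<sigma> n)) (r n) (xs n) (z n)"
    and u: "is_resolvent_VI C (A (\<tau> n)) (r n) (xs n) (u n)"
    and q: "is_resolvent_op (M (\<rho> n)) (r n) (xs n) (q n)" if "n \<ge> 1" for n
    using theI'[OF resolvents_defined(1)] theI'[OF resolvents_defined(2)] theI'[OF resolvents_defined(3)]
      pos[OF that] z_def[OF that] u_def[OF that] q_def[OF that] unfolding resolvent_EP_def resolvent_VI_def resolvent_op_def by auto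
  have qC: "q n \<in> C" if "n \<ge> 1" "xs n \<in> C" for n
    using resC[of "\<rho> n" "r n"] pos[OF that(1)] that q_def by auto

  \<comment> \<open>The Lyapunov estimate for a single step\<close>
  have estimate: "lyapunov p (y n) + \<alpha> 2 * lyapunov (z n) (xs n) + \<alpha> 3 * lyapunov (u n) (xs n)
      + \<alpha> 4 * lyapunov (q n) (xs n) \<le> lyapunov p (xs n)"
    if p: "p \<in> B" and n: "n \<ge> 1" and xC: "xs n \<in> C" for p n
  proof -
    let ?x = "xs n"
    note pos' = pos[OF n]
    have pz: "lyapunov p (z n) + lyapunov (z n) ?x \<le> lyapunov p ?x"
      using p pos' by (intro resolvent_EP_lyapunov[OF f _ z[OF n]]) (auto simp: B_def)
    have pu: "lyapunov p (u n) + lyapunov (u n) ?x \<le> lyapunov p ?x"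
      using p pos' A by (intro resolvent_VI_lyapunov[OF _ _ u[OF n]]) (auto simp: B_def)
    have pq: "lyapunov p (q n) + lyapunov (q n) ?x \<le> lyapunov p ?x"
      using p pos' M by (intro resolvent_op_lyapunov[OF _ _ q[OF n]]) (auto simp: B_def maximal_monotone_def)
    have "p \<in> F_J C (T n)" using p n F_eq by (auto simp: B_def)
    \<comment> \<open>\<open>T n\<close> acts on \<open>q n\<close>, not on \<open>xs n\<close>; the
      resolvent estimate \<open>pq\<close> leads back to \<open>xs n\<close>.\<close>
    then have "lyapunov p (Ji (T n (q n))) \<le> lyapunov p (q n)"
      using T[OF n] qC[OF n xC] by (auto simp: gen_Jstar_nonexpansive_def)
    then have pT: "lyapunov p (Ji (T n (q n))) \<le> lyapunov p ?x"
      using pq lyapunov_nonneg[of "q n" ?x] by linarith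
    define w where "w i = (if i = 1 then J ?x else if i = 2 then J (z n) else if i = 3 then J (u n)
      else if i = 4 then J (q n) else T n (q n))" for i :: nat
    have "lyapunov p (y n) = lyapunov p (Ji (\<Sum>i=1..5. \<alpha> i *\<^sub>R w i))"
      unfolding sum5 y_def[OF n] by (simp add: w_def)
    also have "\<dots> \<le> (\<Sum>i=1..5. \<alpha> i * lyapunov p (Ji (w i)))"
      using \<open>\<And>i. i \<in> {1..5} \<Longrightarrow> \<alpha> i \<in> {0<..<1}\<close> \<open>(\<Sum>i=1..5. \<alpha> i) = 1\<close> by (intro lyapunov_convex_combination) (auto intro: less_imp_le)
    also have "\<dots> = \<alpha> 1 * lyapunov p ?x + \<alpha> 2 * lyapunov p (z n) + \<alpha> 3 * lyapunov p (u n)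
        + \<alpha> 4 * lyapunov p (q n) + \<alpha> 5 * lyapunov p (Ji (T n (q n)))"
      unfolding sum5 by (simp add: w_def)
    also have "\<dots> \<le> \<alpha> 1 * lyapunov p ?x + \<alpha> 2 * (lyapunov p ?x - lyapunov (z n) ?x)
        + \<alpha> 3 * (lyapunov p ?x - lyapunov (u n) ?x) + \<alpha> 4 * (lyapunov p ?x - lyapunov (q n) ?x)
        + \<alpha> 5 * lyapunov p ?x"
      using pz pu pq pT \<alpha> by (intro add_mono mult_left_mono) auto
    also have "\<dots> = (\<alpha> 1 + \<alpha> 2 + \<alpha> 3 + \<alpha> 4 + \<alpha> 5) * lyapunov p ?x - (\<alpha> 2 * lyapunov (z n) ?x
        + \<alpha> 3 * lyapunov (u n) ?x + \<alpha> 4 * lyapunov (q n) ?x)"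
      by (simp add: algebra_simps)
    finally show ?thesis using \<alpha>(6) by simp
  qed

  \<comment> \<open>The shrinking sets and the limit of the iterates\<close>
  have Cs_Suc: "Cs (Suc n) = Cs n \<inter> {v. lyapunov v (y n) \<le> lyapunov v (xs n)}" if "n \<ge> 1" for n
    using Cs_def[OF that] by auto
  \<comment> \<open>The starting point fits the pattern too: \<open>xs 1 = x\<close> is the
    projection of \<open>x\<close> onto \<open>Cs 1 = C\<close>.\<close>
  have xs_proj: "xs (Suc n) = gen_proj (Cs (Suc n)) x" for n
  proof (cases n)
    case 0
    have "gen_proj C x = x"
      using C \<open>x \<in> C\<close> lyapunov_nonneg lyapunov_self by (intro gen_proj_eqI) auto
    then show ?thesis using 0 start by simp
  qed (use xs_def in simp)
  \<comment> \<open>Membership of the iterate in \<open>C\<close> is part of the induction because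
    \<open>estimate\<close> needs it to place \<open>q n\<close> in \<open>C\<close>.\<close>
  have Cs: "closed (Cs (Suc n)) \<and> convex (Cs (Suc n)) \<and> B \<subseteq> Cs (Suc n) \<and> Cs (Suc n) \<subseteq> C \<and> xs (Suc n) \<in> C" for n
  proof (induction n)
    case 0
    have "B \<subseteq> C" by (auto simp: B_def EP_def)
    then show ?case using C start by simp
  next
    case (Suc n)
    have *: "B \<subseteq> {v. lyapunov v (y (Suc n)) \<le> lyapunov v (xs (Suc n))}"
    proof
      fix p assume "p \<in> B"
      then have "lyapunov p (y (Suc n)) + \<alpha> 2 * lyapunov (z (Suc n)) (xs (Suc n))
        + \<alpha> 3 * lyapunov (u (Suc n)) (xs (Suc n)) + \<alpha> 4 * lyapunov (q (Suc n)) (xs (Suc n)) \<le> lyapunov p (xs (Suc n))"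
        using estimate Suc by simp
      moreover have "\<alpha> i * lyapunov v w \<ge> 0" if "\<alpha> i > 0" for i and v w :: 'a
        using that lyapunov_nonneg by simp
      ultimately show "p \<in> {v. lyapunov v (y (Suc n)) \<le> lyapunov v (xs (Suc n))}"
        using \<alpha> by (smt (verit) mem_Collect_eq)
    qed
    then have step: "closed (Cs (Suc (Suc n))) \<and> convex (Cs (Suc (Suc n))) \<and> B \<subseteq> Cs (Suc (Suc n)) \<and> Cs (Suc (Suc n)) \<subseteq> C"
      using Suc Cs_Suc[of "Suc n"] closed_lyapunov_le convex_lyapunov_le
      by (auto intro!: closed_Int convex_Int)
    then have "Cs (Suc (Suc n)) \<noteq> {}" using \<open>B \<noteq> {}\<close> by auto
    then show ?case using step gen_proj(1)[of "Cs (Suc (Suc n))" x] xs_proj[of "Suc n"] by auto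
  qed
  from \<open>B \<noteq> {}\<close> obtain p where p: "p \<in> B" by auto
  have dec: "decseq (\<lambda>n. Cs (Suc n))"
    by (rule decseq_SucI) (use Cs_Suc in auto)
  obtain l where "(\<lambda>n. gen_proj (Cs (Suc n)) x) \<longlonglongrightarrow> l" and lCs: "\<And>n. l \<in> Cs (Suc n)"
    and lmin: "\<And>v. (\<And>n. v \<in> Cs (Suc n)) \<Longrightarrow> lyapunov l x \<le> lyapunov v x"
    using shrinking_projection_convergent[of "\<lambda>n. Cs (Suc n)" p x] Cs dec p by (metis subsetD)
  then have xl: "(\<lambda>n. xs (Suc n)) \<longlonglongrightarrow> l" by (simp add: xs_proj)
  have lC: "l \<in> C" using lCs Cs by blast

  \<comment> \<open>Convergence of the auxiliary sequences to the same limit\<close>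
  have "(\<lambda>n. lyapunov (xs (Suc (Suc n))) (xs (Suc n))) \<longlonglongrightarrow> 0"
    using lyapunov_tendsto[OF LIMSEQ_Suc[OF xl] xl] by (simp add: lyapunov_self)
  \<comment> \<open>The next iterate lies in the set cut out by \<open>y (Suc n)\<close>, whose
    defining inequality is this bound.\<close>
  moreover have "lyapunov (xs (Suc (Suc n))) (y (Suc n)) \<le> lyapunov (xs (Suc (Suc n))) (xs (Suc n))" for n
  proof -
    have "Cs (Suc (Suc n)) \<noteq> {}" using Cs p by blast
    then have "xs (Suc (Suc n)) \<in> Cs (Suc (Suc n))"
      unfolding xs_proj[of "Suc n"] using Cs by (intro gen_proj) auto
    then show ?thesis using Cs_Suc[of "Suc n"] by simp
  qed
  ultimately have "(\<lambda>n. lyapunov (xs (Suc (Suc n))) (y (Suc n))) \<longlonglongrightarrow> 0"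
    by (intro lyapunov_tendsto_zero_le)
  then have yl: "(\<lambda>n. y (Suc n)) \<longlonglongrightarrow> l"
    by (rule lyapunov_tendsto_zero_limit(2)[OF _ disjI1[OF LIMSEQ_Suc[OF xl]]])

  \<comment> \<open>Both sequences tend to \<open>l\<close>, so this slack vanishes, while by
    \<open>estimate\<close> it dominates each weighted resolvent term.\<close>
  define gap where "gap n = lyapunov p (xs (Suc n)) - lyapunov p (y (Suc n))" for n
  have "gap \<longlonglongrightarrow> lyapunov p l - lyapunov p l"
    unfolding gap_def by (intro tendsto_diff lyapunov_tendsto tendsto_const xl yl)
  then have gap: "gap \<longlonglongrightarrow> 0" by simp
  have small: "v \<longlonglongrightarrow> l"
    if "c > 0" "\<And>n. c * lyapunov (v n) (xs (Suc n)) \<le> gap n" for c and v :: "nat \<Rightarrow> 'a"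
  proof -
    have "(\<lambda>n. gap n / c) \<longlonglongrightarrow> 0" using tendsto_divide[OF gap tendsto_const[of c]] that(1) by simp
    moreover have "lyapunov (v n) (xs (Suc n)) \<le> gap n / c" for n using that by (simp add: pos_le_divide_eq mult.commute)
    ultimately have "(\<lambda>n. lyapunov (v n) (xs (Suc n))) \<longlonglongrightarrow> 0"
      by (intro lyapunov_tendsto_zero_le)
    then show ?thesis by (rule lyapunov_tendsto_zero_limit(1)[OF _ disjI2[OF xl]])
  qed
  have nonneg: "0 \<le> \<alpha> 2 * lyapunov (z n) (xs n)" "0 \<le> \<alpha> 3 * lyapunov (u n) (xs n)"
      "0 \<le> \<alpha> 4 * lyapunov (q n) (xs n)" for n
    using \<alpha> lyapunov_nonneg by simp_all
  have est: "\<alpha> 2 * lyapunov (z (Suc n)) (xs (Suc n)) + \<alpha> 3 * lyapunov (u (Suc n)) (xs (Suc n))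
      + \<alpha> 4 * lyapunov (q (Suc n)) (xs (Suc n)) \<le> gap n" for n
    using estimate[OF p, of "Suc n"] Cs[of n] by (simp add: gap_def)
  have zl: "(\<lambda>n. z (Suc n)) \<longlonglongrightarrow> l"
    by (rule small[OF \<alpha>(2)]) (use est nonneg in \<open>smt (verit)\<close>)
  have ul: "(\<lambda>n. u (Suc n)) \<longlonglongrightarrow> l"
    by (rule small[OF \<alpha>(3)]) (use est nonneg in \<open>smt (verit)\<close>)
  have ql: "(\<lambda>n. q (Suc n)) \<longlonglongrightarrow> l"
    by (rule small[OF \<alpha>(4)]) (use est nonneg in \<open>smt (verit)\<close>)

  \<comment> \<open>Membership of the limit in \<open>F_J_family C \<Gamma>\<close>\<close>
  have Tq: "T (Suc n) (q (Suc n)) = (1 / \<alpha> 5) *\<^sub>R (J (y (Suc n)) - (\<alpha> 1 *\<^sub>R J (xs (Suc n))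
      + \<alpha> 2 *\<^sub>R J (z (Suc n)) + \<alpha> 3 *\<^sub>R J (u (Suc n)) + \<alpha> 4 *\<^sub>R J (q (Suc n))))" for n
    using y_def[of "Suc n"] \<alpha>(5) by simp
  have "(\<lambda>n. T (Suc n) (q (Suc n))) \<longlonglongrightarrow>
      (1 / \<alpha> 5) *\<^sub>R (J l - (\<alpha> 1 *\<^sub>R J l + \<alpha> 2 *\<^sub>R J l + \<alpha> 3 *\<^sub>R J l + \<alpha> 4 *\<^sub>R J l))"
    unfolding Tq by (intro tendsto_intros duality_map_tendsto xl yl zl ul ql)
  \<comment> \<open>As the weights sum to 1, the coefficient left for \<open>J l\<close> is
    \<open>\<alpha> 5\<close>, which cancels the division.\<close>
  also have "J l - (\<alpha> 1 *\<^sub>R J l + \<alpha> 2 *\<^sub>R J l + \<alpha> 3 *\<^sub>R J l + \<alpha> 4 *\<^sub>R J l)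
      = (1 - (\<alpha> 1 + \<alpha> 2 + \<alpha> 3 + \<alpha> 4)) *\<^sub>R J l"
    by (simp add: algebra_simps)
  also have "1 - (\<alpha> 1 + \<alpha> 2 + \<alpha> 3 + \<alpha> 4) = \<alpha> 5" using \<alpha>(6) by simp
  finally have Tl: "(\<lambda>n. T (Suc n) (q (Suc n))) \<longlonglongrightarrow> J l" using \<alpha>(5) by simp
  have "(\<lambda>n. norm (J (q (Suc n)) - T (Suc n) (q (Suc n)))) \<longlonglongrightarrow> 0"
    using tendsto_norm_zero[of "\<lambda>n. J (q (Suc n)) - T (Suc n) (q (Suc n))"]
      tendsto_diff[OF duality_map_tendsto[OF ql] Tl] by simp
  then have "(\<lambda>n. norm (J (q n) - T n (q n))) \<longlonglongrightarrow> 0" by (rule LIMSEQ_imp_Suc)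
  moreover have "q n \<in> C" if "n \<ge> 1" for n using that qC Cs[of "n - 1"] by simp
  moreover have "q ` {1..} = range (\<lambda>n. q (Suc n))"
    by (auto simp: image_iff) (metis Suc_le_D)
  then have "bounded (q ` {1..})" using convergent_imp_bounded[OF ql] by simp
  ultimately have NST: "(\<lambda>n. norm (J (q n) - S (q n))) \<longlonglongrightarrow> 0" if "S \<in> \<Gamma>" for S
    using \<open>NST_condition C T \<Gamma>\<close> that unfolding NST_condition_def by blast

  have "l \<in> F_J C S" if S: "S \<in> \<Gamma>" for S
  proof -
    have "(\<lambda>n. J (q (Suc n)) - S (q (Suc n))) \<longlonglongrightarrow> 0"
      using LIMSEQ_Suc[OF NST[OF S]] by (simp add: tendsto_norm_zero_iff)
    from tendsto_diff[OF duality_map_tendsto[OF ql] this]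
    have "(\<lambda>n. S (q (Suc n))) \<longlonglongrightarrow> J l" by simp
    then have "(\<lambda>n. (Ji \<circ> S) (q (Suc n))) \<longlonglongrightarrow> l" using duality_map_inv_tendsto by simp
    moreover have "Jstar_closed C S" using \<Gamma>[OF S] ..
    moreover have "q (Suc n) \<in> C" for n using qC Cs by simp
    ultimately have "l = (Ji \<circ> S) l"
      using lC ql unfolding Jstar_closed_def by (auto dest: spec[of _ "\<lambda>n. q (Suc n)"])
    then have "S l = J l" using duality_map_inverse(2)[of "S l"] by simp
    then show ?thesis using lC by (simp add: F_J_def)
  qed
  then have lF: "l \<in> F_J_family C \<Gamma>" by (simp add: F_J_family_def)

  \<comment> \<open>Membership of the limit in the other solution sets\<close>
  have subseq: "\<exists>g :: nat \<Rightarrow> nat. strict_mono g \<and> (\<forall>n. g n \<ge> 1 \<and> \<mu> (g n) = m)"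
    if "infinite {n. n \<ge> 1 \<and> \<mu> n = m}" for m and \<mu> :: "nat \<Rightarrow> nat"
    using infinite_enumerate[OF that] by simp
  have sub: "(v \<circ> g) \<longlonglongrightarrow> l" if "(\<lambda>n. v (Suc n)) \<longlonglongrightarrow> l" "strict_mono g" for v :: "nat \<Rightarrow> 'a" and g
    by (rule LIMSEQ_subseq_LIMSEQ[OF LIMSEQ_imp_Suc[OF that(1)] that(2)])
  \<comment> \<open>The index \<open>i\<close> recurs infinitely often, so a subsequence uses the
    single bifunction \<open>f i\<close>, and its resolvents still tend to \<open>l\<close>.\<close>
  have "l \<in> EP C (f i)" if i: "i \<ge> 1" for i
  proof -
    obtain g :: "nat \<Rightarrow> nat" where g: "strict_mono g" "\<And>n. g n \<ge> 1" "\<And>n. \<sigma> (g n) = i"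
      using subseq[OF inf(1)[OF i]] by metis
    have "is_resolvent_EP C (f i) ((r \<circ> g) n) ((xs \<circ> g) n) ((z \<circ> g) n)" for n
      using z[OF g(2)[of n]] g(3)[of n] by simp
    then show ?thesis
      using C \<open>convex (J ` C)\<close> f[OF i] r g sub[OF zl g(1)] sub[OF xl g(1)]
      by (intro resolvent_EP_limit[where r = "r \<circ> g" and x = "xs \<circ> g" and z = "z \<circ> g" and a = a]) auto
  qed
  moreover have "l \<in> VI C (A j)" if j: "j \<ge> 1" for j
  proof -
    obtain g :: "nat \<Rightarrow> nat" where g: "strict_mono g" "\<And>n. g n \<ge> 1" "\<And>n. \<tau> (g n) = j"
      using subseq[OF inf(2)[OF j]] by metis
    have "is_resolvent_VI C (A j) ((r \<circ> g) n) ((xs \<circ> g) n) ((u \<circ> g) n)" for n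
      using u[OF g(2)[of n]] g(3)[of n] by simp
    then show ?thesis
      using C A[OF j] r g sub[OF ul g(1)] sub[OF xl g(1)]
      by (intro resolvent_VI_limit[where r = "r \<circ> g" and x = "xs \<circ> g" and z = "u \<circ> g" and a = a]) auto
  qed
  moreover have "l \<in> zeros (M k)" if k: "k \<ge> 1" for k
  proof -
    obtain g :: "nat \<Rightarrow> nat" where g: "strict_mono g" "\<And>n. g n \<ge> 1" "\<And>n. \<rho> (g n) = k"
      using subseq[OF inf(3)[OF k]] by metis
    have "is_resolvent_op (M k) ((r \<circ> g) n) ((xs \<circ> g) n) ((q \<circ> g) n)" for n
      using q[OF g(2)[of n]] g(3)[of n] by simp
    then show ?thesis
      using M[OF k] r g sub[OF ql g(1)] sub[OF xl g(1)]
      by (intro resolvent_op_limit[where r = "r \<circ> g" and x = "xs \<circ> g" and z = "q \<circ> g" and a = a]) auto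
  qed
  ultimately have "l \<in> B" using lF by (simp add: B_def)
  \<comment> \<open>\<open>B\<close> lies in every shrinking set, so minimality of \<open>l\<close>
    over their intersection restricts to \<open>B\<close>.\<close>
  moreover have "lyapunov l x \<le> lyapunov v x" if "v \<in> B" for v
    using that Cs by (intro lmin) blast
  ultimately have "gen_proj B x = l"
    using \<open>closed B\<close> \<open>convex B\<close> by (intro gen_proj_eqI)
  then show ?thesis using LIMSEQ_imp_Suc[OF xl] by simp
qed

end
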